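(* Let $J\subset S$ be a square-free monomial ideal with minimal primary decomposition $J=\mathfrak{p}_1\cap\cdots\cap\mathfrak{p}_k$. Suppose that the Stanley–Reisner complex $\Delta(J)$ is shellable with shelling order of the facets $F_1,\ldots,F_k$, where $F_i$ corresponds to $\mathfrak{p}_i$. Let $c$ be the common codimension of the primes $\mathfrak{p}_i$. Then $$P_{S/J}(\mathbf{t})=\sum_{j=1}^k\big(P_{S/\mathfrak{p}_j}(\mathbf{t})-D_j(\mathbf{t})\big),$$ where $D_j(\mathbf{t})=\mathrm{IE}(\mathfrak{P}_j)(\mathbf{t})$ and $\mathfrak{P}_j$ is the following sequence (without repetitions) of prime ideals: $$\mathfrak{P}_j=\{\mathfrak{p}_\ell+\mathfrak{p}_j\mid1\le\ell\le j-1\text{ and }\mathrm{codim}(\mathfrak{p}_\ell+\mathfrak{p}_j)=c+1\}.$$ Furthermore, for each $1\le j\le k$ there exists a set of distinct variables $\{x_{\ell_{j,1}},\ldots,x_{\ell_{j,b_j}}\}\subset\mathfrak{p}_{[j-1]}\setminus\mathfrak{p}_j$ such that $\mathfrak{P}_j=\{(\mathfrak{p}_j,x_{\ell_{j,1}}),\ldots,(\mathfrak{p}_j,x_{\ell_{j,b_j}})\}$.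
   Context: $\Bbbk$ is a field and $S=\Bbbk[x_1,\ldots,x_n]$ is a standard $\mathbb{N}^p$-graded polynomial ring, i.e. $\deg(x_i)\in\{\mathbf{e}_1,\ldots,\mathbf{e}_p\}$ for each $i$. For a finitely generated $\mathbb{Z}^p$-graded $S$-module $M$, $P_M(\mathbf{t})\in\mathbb{Q}[t_1,\ldots,t_p]$ denotes its multigraded Hilbert polynomial: $P_M(\mathbf{v})=\dim_\Bbbk([M]_{\mathbf{v}})$ for all $\mathbf{v}\gg\mathbf{0}$. For a square-free monomial ideal $J$, $\Delta(J)$ is its Stanley–Reisner simplicial complex on the variables; the facet corresponding to a minimal prime $\mathfrak{p}$ of $J$ is the set of variables not in $\mathfrak{p}$. A simplicial complex with facets $F_1,\ldots,F_k$ is shellable with order $F_1,\ldots,F_k$ if it is pure and $\langle F_1,\ldots,F_{i-1}\rangle\cap\langle F_i\rangle$ is pure of dimension $\dim(F_i)-1$ for all $2\le i\le k$, where $\langle\cdots\rangle$ denotes the generated simplicial complex. For a sequence of primes $\mathfrak{q}_1,\ldots,\mathfrak{q}_r$ and a subset $A\subseteq[r]=\{1,\ldots,r\}$ set $\mathfrak{q}_A=\sum_{i\in A}\mathfrak{q}_i$, with $\mathfrak{q}_\emptyset=S$, and define $\mathrm{IE}(\{\mathfrak{q}_1,\ldots,\mathfrak{q}_r\})(\mathbf{t})=\sum_{A\subseteq[r]}(-1)^{|A|-1}P_{S/\mathfrak{q}_A}(\mathbf{t})$ (so the empty set contributes $0$, and $\mathrm{IE}$ of the empty sequence is $0$). In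 particular $\mathfrak{p}_{[j-1]}=\mathfrak{p}_1+\cdots+\mathfrak{p}_{j-1}$. The notation $(\mathfrak{p}_j,x)$ means $\mathfrak{p}_j+(x)$. *)

theory Defs
  imports "HOL-Algebra.QuotRing" "HOL-Algebra.Embedded_Algebras" "HOL-Library.Poly_Mapping" "HOL-Library.Extended_Nat"
begin

section \<open>Commutative algebra\<close>

definition radical_of :: "('a, 'b) ring_scheme \<Rightarrow> 'a set \<Rightarrow> 'a set" where
  "radical_of R I = {a \<in> carrier R. \<exists>n::nat. a [^]\<^bsub>R\<^esub> n \<in> I}"

definition primary_ideal :: "('a, 'b) ring_scheme \<Rightarrow> 'a set \<Rightarrow> bool" where
  "primary_ideal R Q \<longleftrightarrow> ideal Q R \<and> Q \<noteq> carrier R \<and>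
     (\<forall>a\<in>carrier R. \<forall>b\<in>carrier R. a \<otimes>\<^bsub>R\<^esub> b \<in> Q \<longrightarrow> a \<in> Q \<or> b \<in> radical_of R Q)"

definition minimal_primary_decomposition ::
    "('a, 'b) ring_scheme \<Rightarrow> 'a set \<Rightarrow> (nat \<Rightarrow> 'a set) \<Rightarrow> nat \<Rightarrow> bool" where
  "minimal_primary_decomposition R J q k \<longleftrightarrow>
     (\<forall>i\<in>{1..k}. primary_ideal R (q i)) \<and>
     J = carrier R \<inter> (\<Inter>i\<in>{1..k}. q i) \<and>
     inj_on (\<lambda>i. radical_of R (q i)) {1..k} \<and>
     (\<forall>i\<in>{1..k}. \<not> carrier R \<inter> (\<Inter>j\<in>{1..k} - {i}. q j) \<subseteq> q i)"

text \<open>The height of a prime is the supremum of the lengths of the chains of primes ending in it;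
  the codimension of an arbitrary ideal is the least height of a prime containing it.\<close>

definition height :: "('a, 'b) ring_scheme \<Rightarrow> 'a set \<Rightarrow> enat" where
  "height R P = Sup {enat n |n. \<exists>C :: nat \<Rightarrow> 'a set.
     (\<forall>i\<le>n. primeideal (C i) R) \<and> (\<forall>i<n. C i \<subset> C (Suc i)) \<and> C n = P}"

definition codim :: "('a, 'b) ring_scheme \<Rightarrow> 'a set \<Rightarrow> enat" where
  "codim R I = (INF P\<in>{P. primeideal P R \<and> I \<subseteq> P}. height R P)"

text \<open>The sum of a family of ideals, i.e. the ideal generated by their union, except that the
  empty sum is by convention the whole ring and not the zero ideal.\<close>

definition ideal_sum :: "('a, 'b) ring_scheme \<Rightarrow> (nat \<Rightarrow> 'a set) \<Rightarrow> nat set \<Rightarrow> 'a set" where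
  "ideal_sum R q A = (if A = {} then carrier R else genideal R (\<Union>i\<in>A. q i))"


section \<open>The multigraded polynomial ring\<close>

text \<open>Polynomials with coefficients in \<open>'k\<close> and variables indexed by \<open>'v\<close>, as finitely supported
  functions on exponent vectors; the multiplication of \<^type>\<open>poly_mapping\<close> is convolution.\<close>

type_synonym ('v, 'k) mpolynomial = "('v \<Rightarrow>\<^sub>0 nat) \<Rightarrow>\<^sub>0 'k"

definition mpoly_ring :: "('v::finite, 'k::field) mpolynomial ring" where
  "mpoly_ring = \<lparr>carrier = UNIV, monoid.mult = (*), one = 1, ring.zero = 0, add = (+)\<rparr>"

definition monomial :: "('v \<Rightarrow>\<^sub>0 nat) \<Rightarrow> ('v, 'k::field) mpolynomial" where
  "monomial m = Poly_Mapping.single m 1"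

definition Var :: "'v \<Rightarrow> ('v, 'k::field) mpolynomial" where
  "Var i = monomial (Poly_Mapping.single i 1)"

definition Const :: "'k \<Rightarrow> ('v, 'k::field) mpolynomial" where
  "Const a = Poly_Mapping.single 0 a"

definition unit_vector :: "'p \<Rightarrow> 'p \<Rightarrow> nat" where
  "unit_vector l = (\<lambda>m. if m = l then 1 else 0)"

text \<open>A grading is given by the degrees \<open>\<delta> i\<close> of the variables.\<close>

definition standard_grading :: "('v \<Rightarrow> 'p \<Rightarrow> nat) \<Rightarrow> bool" where
  "standard_grading \<delta> \<longleftrightarrow> (\<forall>i. \<delta> i \<in> range unit_vector)"

definition multidegree :: "('v::finite \<Rightarrow> 'p \<Rightarrow> nat) \<Rightarrow> ('v \<Rightarrow>\<^sub>0 nat) \<Rightarrow> 'p \<Rightarrow> nat" where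
  "multidegree \<delta> m = (\<lambda>l. \<Sum>i\<in>UNIV. Poly_Mapping.lookup m i * \<delta> i l)"

definition graded_part ::
    "('v::finite \<Rightarrow> 'p \<Rightarrow> nat) \<Rightarrow> ('p \<Rightarrow> nat) \<Rightarrow> ('v, 'k::field) mpolynomial set" where
  "graded_part \<delta> v = {f. \<forall>m\<in>Poly_Mapping.keys f. multidegree \<delta> m = v}"

text \<open>For a homogeneous ideal \<open>I\<close>, the dimension of the degree \<open>v\<close> part of the quotient by \<open>I\<close>,
  which is the image of the degree \<open>v\<close> part of the polynomial ring, as a vector space over
  the image of the constants.\<close>

definition hilbert_function ::
    "('v::finite \<Rightarrow> 'p \<Rightarrow> nat) \<Rightarrow> ('v, 'k::field) mpolynomial set \<Rightarrow> ('p \<Rightarrow> nat) \<Rightarrow> nat" where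
  "hilbert_function \<delta> I v =
     ring.dim (mpoly_ring Quot I)
       (range (\<lambda>a. I +>\<^bsub>mpoly_ring\<^esub> Const a)) ((\<lambda>f. I +>\<^bsub>mpoly_ring\<^esub> f) ` graded_part \<delta> v)"

definition eval_poly :: "(('p::finite \<Rightarrow>\<^sub>0 nat) \<Rightarrow>\<^sub>0 rat) \<Rightarrow> ('p \<Rightarrow> nat) \<Rightarrow> rat" where
  "eval_poly P v = (\<Sum>m\<in>Poly_Mapping.keys P.
     Poly_Mapping.lookup P m * (\<Prod>l\<in>UNIV. of_nat (v l) ^ Poly_Mapping.lookup m l))"

text \<open>The multigraded Hilbert polynomial of the quotient by the homogeneous ideal \<open>I\<close>.\<close>

definition hilbert_polynomial ::
    "('v::finite \<Rightarrow> 'p::finite \<Rightarrow> nat) \<Rightarrow> ('v, 'k::field) mpolynomial set \<Rightarrow> ('p \<Rightarrow>\<^sub>0 nat) \<Rightarrow>\<^sub>0 rat" where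
  "hilbert_polynomial \<delta> I = (THE P. \<exists>N. \<forall>v. (\<forall>l. N \<le> v l) \<longrightarrow>
     eval_poly P v = of_nat (hilbert_function \<delta> I v))"

text \<open>The sign \<open>(-1) ^ (card A - 1)\<close> is written with exponent \<open>card A + 1\<close> to avoid truncated
  subtraction at the empty set. A sequence is a list, indexed from 0.\<close>

definition IE ::
    "('v::finite \<Rightarrow> 'p::finite \<Rightarrow> nat) \<Rightarrow> ('v, 'k::field) mpolynomial set list \<Rightarrow> ('p \<Rightarrow>\<^sub>0 nat) \<Rightarrow>\<^sub>0 rat" where
  "IE \<delta> qs = (\<Sum>A\<in>Pow {..<length qs}.
     (-1) ^ (card A + 1) * hilbert_polynomial \<delta> (ideal_sum mpoly_ring (\<lambda>i. qs ! i) A))"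

text \<open>The sequence, without repetitions, of the ideals \<open>p l + p j\<close> with \<open>1 \<le> l < j\<close> that have
  codimension \<open>c + 1\<close>.\<close>

definition prime_seq ::
    "(nat \<Rightarrow> ('v::finite, 'k::field) mpolynomial set) \<Rightarrow> nat \<Rightarrow> nat \<Rightarrow> ('v, 'k) mpolynomial set list" where
  "prime_seq p c j = remdups (filter (\<lambda>I. codim mpoly_ring I = enat (c + 1))
     (map (\<lambda>l. p l <+>\<^bsub>mpoly_ring\<^esub> p j) [1..<j]))"


section \<open>Simplicial complexes\<close>

text \<open>A simplicial complex is a set of faces closed under taking subsets.\<close>

definition facets :: "'v set set \<Rightarrow> 'v set set" where
  "facets \<Delta> = {F \<in> \<Delta>. \<forall>G\<in>\<Delta>. F \<subseteq> G \<longrightarrow> F = G}"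

definition generated_complex :: "'v set set \<Rightarrow> 'v set set" where
  "generated_complex \<F> = {G. \<exists>F\<in>\<F>. G \<subseteq> F}"

definition face_dim :: "'v set \<Rightarrow> int" where
  "face_dim F = int (card F) - 1"

definition pure_of_dim :: "int \<Rightarrow> 'v set set \<Rightarrow> bool" where
  "pure_of_dim d \<Delta> \<longleftrightarrow> (\<forall>F\<in>facets \<Delta>. face_dim F = d)"

definition shelling_order :: "'v set set \<Rightarrow> (nat \<Rightarrow> 'v set) \<Rightarrow> nat \<Rightarrow> bool" where
  "shelling_order \<Delta> F k \<longleftrightarrow>
     facets \<Delta> = F ` {1..k} \<and> inj_on F {1..k} \<and>
     (\<exists>d. pure_of_dim d \<Delta>) \<and>
     (\<forall>i\<in>{2..k}. pure_of_dim (face_dim (F i) - 1)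
        (generated_complex (F ` {1..i - 1}) \<inter> generated_complex {F i}))"

definition squarefree_monomial_ideal :: "('v::finite, 'k::field) mpolynomial set \<Rightarrow> bool" where
  "squarefree_monomial_ideal J \<longleftrightarrow>
     (\<exists>G. (\<forall>m\<in>G. \<forall>i. Poly_Mapping.lookup m i \<le> 1) \<and> J = genideal mpoly_ring (monomial ` G))"

definition stanley_reisner_complex :: "('v::finite, 'k::field) mpolynomial set \<Rightarrow> 'v set set" where
  "stanley_reisner_complex J = {F. (\<Prod>i\<in>F. Var i) \<notin> J}"

definition face_of_prime :: "('v::finite, 'k::field) mpolynomial set \<Rightarrow> 'v set" where
  "face_of_prime P = {i. Var i \<notin> P}"

end

theory Submission
  imports Defs "HOL-Computational_Algebra.Polynomial"
begin

text \<open>Every \<open>p i\<close> is the prime generated by the variables outside the facet \<open>F i\<close>, and all ideals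
  in the formula are spanned by the monomials whose support avoids some simplicial complex. The
  Hilbert polynomial of such a quotient is the sum, over the faces \<open>G\<close> of the complex, of the
  polynomial counting the monomials with support exactly \<open>G\<close>. By inclusion-exclusion the correction
  term \<open>IE\<close> is the same sum over the union of the simplices on the sets \<open>F l \<inter> F j\<close> that belong to
  \<open>prime_seq p c j\<close>, which are those with one vertex less than \<open>F j\<close>. For a shelling this union
  consists of all faces of \<open>F j\<close> that lie in an earlier facet, so every face of the complex is
  counted once, at the first facet containing it.\<close>

text \<open>Codimension is defined by chains of arbitrary primes, so even for ideals spanned by
  monomials it cannot simply be read off the faces: a longer chain might pass through primes that
  are not monomial. Bounding the length of such chains is the obstacle outside combinatorics, and a
  growth count for independent polynomials overcomes it. The ideals \<open>p i\<close> are likewise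
  given only as primes. \<open>face_of_prime\<close> records which variables they contain; that
  these variables generate them has to be derived from the intersection and from the maximality of
  facets. Counting by exact support makes every Hilbert polynomial additive in the complex, so the
  formula becomes an identity between sums over finite sets of faces, without exact sequences. The
  variables of the second claim are missing vertices: if \<open>F l \<inter> F j\<close> is
  \<open>F j\<close> without x, then \<open>p l + p j\<close> is \<open>p j + (x)\<close>, and x
  lies in \<open>p l\<close> because it is not in \<open>F l\<close>.\<close>

abbreviation (input) keys :: "('a \<Rightarrow>\<^sub>0 'b::zero) \<Rightarrow> 'a set" where
  "keys \<equiv> Poly_Mapping.keys"

abbreviation (input) lookup :: "('a \<Rightarrow>\<^sub>0 'b::zero) \<Rightarrow> 'a \<Rightarrow> 'b" where
  "lookup \<equiv> Poly_Mapping.lookup"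


section \<open>Ideals of the polynomial ring\<close>

lemma mpoly_ring_simps [simp]:
  "carrier mpoly_ring = UNIV"
  "x \<otimes>\<^bsub>mpoly_ring\<^esub> y = x * y"
  "x \<oplus>\<^bsub>mpoly_ring\<^esub> y = x + y"
  "\<one>\<^bsub>mpoly_ring\<^esub> = 1"
  "\<zero>\<^bsub>mpoly_ring\<^esub> = 0"
  by (simp_all add: mpoly_ring_def)

lemma cring_mpoly_ring: "cring (mpoly_ring :: ('v::finite, 'k::field) mpolynomial ring)"
proof (rule cringI)
  show "abelian_group (mpoly_ring :: ('v, 'k) mpolynomial ring)"
    by (rule abelian_groupI) (auto simp: algebra_simps intro: exI[of _ "- x" for x])
  show "comm_monoid (mpoly_ring :: ('v, 'k) mpolynomial ring)"
    by (rule comm_monoidI) (auto simp: algebra_simps)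
qed (auto simp: algebra_simps)

lemma ring_mpoly_ring: "ring (mpoly_ring :: ('v::finite, 'k::field) mpolynomial ring)"
  by (rule cring.axioms(1)[OF cring_mpoly_ring])

lemma a_inv_mpoly_ring [simp]: "\<ominus>\<^bsub>mpoly_ring\<^esub> x = - (x :: ('v::finite, 'k::field) mpolynomial)"
proof -
  interpret cring "mpoly_ring :: ('v, 'k) mpolynomial ring" by (rule cring_mpoly_ring)
  show ?thesis by (rule minus_equality) auto
qed

lemma ideal_mpoly_iff:
  "ideal I (mpoly_ring :: ('v::finite, 'k::field) mpolynomial ring) \<longleftrightarrow>
     0 \<in> I \<and> (\<forall>a\<in>I. \<forall>b\<in>I. a + b \<in> I) \<and> (\<forall>a\<in>I. \<forall>r. r * a \<in> I)"
proof
  assume I: "ideal I (mpoly_ring :: ('v, 'k) mpolynomial ring)"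
  interpret ideal I mpoly_ring by fact
  show "0 \<in> I \<and> (\<forall>a\<in>I. \<forall>b\<in>I. a + b \<in> I) \<and> (\<forall>a\<in>I. \<forall>r. r * a \<in> I)"
  proof (intro conjI ballI allI)
    show "0 \<in> I" using additive_subgroup.zero_closed[OF is_additive_subgroup] by simp
    show "a + b \<in> I" if "a \<in> I" "b \<in> I" for a b
      using additive_subgroup.a_closed[OF is_additive_subgroup that] by simp
    show "r * a \<in> I" if "a \<in> I" for r a
      using I_l_closed[OF that, of r] by simp
  qed
next
  assume I: "0 \<in> I \<and> (\<forall>a\<in>I. \<forall>b\<in>I. a + b \<in> I) \<and> (\<forall>a\<in>I. \<forall>r. r * a \<in> I)"
  interpret cring "mpoly_ring :: ('v, 'k) mpolynomial ring" by (rule cring_mpoly_ring)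
  show "ideal I (mpoly_ring :: ('v, 'k) mpolynomial ring)"
  proof (rule idealI[OF ring_mpoly_ring])
    have uminus: "- x \<in> I" if "x \<in> I" for x
      using I that mult_minus1[of x] by metis
    show "subgroup I (add_monoid mpoly_ring)"
    proof (rule add.subgroupI)
      show "\<ominus>\<^bsub>mpoly_ring\<^esub> a \<in> I" if "a \<in> I" for a
        using uminus[OF that] by simp
    qed (use I in auto)
  qed (use I in \<open>auto simp: mult.commute\<close>)
qed

lemma ideal_diff:
  assumes "ideal I (mpoly_ring :: ('v::finite, 'k::field) mpolynomial ring)" "a \<in> I" "b \<in> I"
  shows "a - b \<in> I"
proof -
  have "a + (-1) * b \<in> I" using assms unfolding ideal_mpoly_iff by blast
  then show ?thesis by simp
qed

lemma ideal_sum_mem: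
  assumes "ideal I (mpoly_ring :: ('v::finite, 'k::field) mpolynomial ring)"
    and "\<And>i. i \<in> A \<Longrightarrow> f i \<in> I"
  shows "sum f A \<in> I"
  using assms(2)
  by (induction A rule: infinite_finite_induct) (use assms(1) in \<open>auto simp: ideal_mpoly_iff\<close>)

lemma primeideal_mpoly_iff:
  "primeideal P (mpoly_ring :: ('v::finite, 'k::field) mpolynomial ring) \<longleftrightarrow>
     ideal P mpoly_ring \<and> P \<noteq> UNIV \<and> (\<forall>a b. a * b \<in> P \<longrightarrow> a \<in> P \<or> b \<in> P)"
  (is "?l \<longleftrightarrow> ?r")
proof
  assume ?l
  then interpret primeideal P mpoly_ring .
  show ?r using I_notcarr I_prime ideal_axioms by auto
next
  assume ?r
  then show ?l by (intro primeidealI[OF _ cring_mpoly_ring]) auto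
qed

lemma genideal_mpoly_eqI:
  assumes "ideal I (mpoly_ring :: ('v::finite, 'k::field) mpolynomial ring)" "G \<subseteq> I"
    and "\<And>K. ideal K (mpoly_ring :: ('v, 'k) mpolynomial ring) \<Longrightarrow> G \<subseteq> K \<Longrightarrow> I \<subseteq> K"
  shows "genideal mpoly_ring G = I"
  using assms ring.genideal_ideal[OF ring_mpoly_ring, of G] ring.genideal_self[OF ring_mpoly_ring, of G]
    ring.genideal_minimal[OF ring_mpoly_ring, of I G]
  by (intro equalityI) auto

section \<open>Expansion of polynomials into monomials\<close>

lemma poly_eq_sum_single: "f = (\<Sum>m\<in>keys f. Poly_Mapping.single m (lookup f m))"
  by (rule poly_mapping_eqI)
     (simp add: lookup_sum lookup_single when_def sum.delta in_keys_iff)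

lemma Const_mult_monomial: "Const a * monomial m = Poly_Mapping.single m a"
  by (simp add: Const_def monomial_def mult_single)

lemma keys_monomial [simp]: "keys (monomial m :: ('v, 'k::field) mpolynomial) = {m}"
  by (simp add: monomial_def)

lemma mem_ideal_of_monomials:
  assumes "ideal I (mpoly_ring :: ('v::finite, 'k::field) mpolynomial ring)"
    and "\<And>m. m \<in> keys f \<Longrightarrow> monomial m \<in> I"
  shows "f \<in> I"
proof -
  have "(\<Sum>m\<in>keys f. Const (lookup f m) * monomial m) \<in> I"
    using assms by (intro ideal_sum_mem) (auto simp: ideal_mpoly_iff)
  then show ?thesis
    by (simp add: Const_mult_monomial flip: poly_eq_sum_single)
qed

lemma lookup_mult_keys:
  fixes f g :: "('v::finite, 'k::field) mpolynomial"
  shows "lookup (f * g) m = (\<Sum>a\<in>keys f. \<Sum>b\<in>keys g. if a + b = m then lookup f a * lookup g b else 0)"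
proof -
  have "f * g = (\<Sum>a\<in>keys f. \<Sum>b\<in>keys g. Poly_Mapping.single (a + b) (lookup f a * lookup g b))"
    by (subst (1) poly_eq_sum_single[of f], subst (1) poly_eq_sum_single[of g])
       (simp only: sum_product mult_single)
  then show ?thesis
    by (simp add: lookup_sum lookup_single when_def)
qed

lemma keys_multE:
  assumes "m \<in> keys (f * g)"
  obtains a b where "a \<in> keys f" "b \<in> keys g" "m = a + b"
  using keys_mult[of f g] assms by auto

lemma keys_add_exponents: "keys (a + b :: 'v \<Rightarrow>\<^sub>0 nat) = keys a \<union> keys b"
  by (auto simp: in_keys_iff lookup_add)

lemma monomial_add: "monomial (a + b) = monomial a * monomial b"
  by (simp add: monomial_def mult_single)

lemma monomial_multiple_mem_ideal:
  assumes "ideal I (mpoly_ring :: ('v::finite, 'k::field) mpolynomial ring)"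
    and "monomial g \<in> I" and "\<And>i. lookup g i \<le> lookup m i"
  shows "monomial m \<in> I"
proof -
  have "m = (m - g) + g"
    by (rule poly_mapping_eqI) (simp add: lookup_add lookup_minus assms(3))
  then have "monomial m = monomial (m - g) * (monomial g :: ('v, 'k) mpolynomial)"
    by (metis monomial_add)
  then show ?thesis using assms(1,2) by (simp add: ideal_mpoly_iff)
qed


section \<open>Ideals of simplicial complexes\<close>

text \<open>In particular \<open>face_ideal (Pow F)\<close> is the prime generated by the variables outside \<open>F\<close>, and
  \<open>face_ideal {}\<close> is the whole ring.\<close>

definition face_ideal :: "'v set set \<Rightarrow> ('v::finite, 'k::field) mpolynomial set" where
  "face_ideal D = {f. \<forall>m\<in>keys f. keys m \<notin> D}"

text \<open>The empty family qualifies, so the whole ring, which is the value of the empty ideal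
  sum, is among the ideals treated.\<close>

definition down_closed :: "'v set set \<Rightarrow> bool" where
  "down_closed D \<longleftrightarrow> (\<forall>F\<in>D. \<forall>G. G \<subseteq> F \<longrightarrow> G \<in> D)"

lemma down_closed_Pow [simp]: "down_closed (Pow F)"
  by (auto simp: down_closed_def)

lemma monomial_mem_face_ideal: "monomial m \<in> face_ideal D \<longleftrightarrow> keys m \<notin> D"
  by (simp add: face_ideal_def)

lemma face_ideal_antimono: "D \<subseteq> E \<Longrightarrow> face_ideal E \<subseteq> face_ideal D"
  by (auto simp: face_ideal_def)

lemma face_ideal_Union: "face_ideal (\<Union>i\<in>A. D i) = (\<Inter>i\<in>A. face_ideal (D i))"
  by (auto simp: face_ideal_def)

lemma face_ideal_empty [simp]: "face_ideal {} = UNIV"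
  by (auto simp: face_ideal_def)

text \<open>Multiplication by a monomial only enlarges supports, and a set containing a nonface is a
  nonface.\<close>

lemma ideal_face_ideal:
  assumes "down_closed (D :: 'v::finite set set)"
  shows "ideal (face_ideal D :: ('v, 'k::field) mpolynomial set) mpoly_ring"
  unfolding ideal_mpoly_iff
proof (intro conjI ballI allI)
  fix f g :: "('v, 'k) mpolynomial"
  assume f: "f \<in> face_ideal D"
  show "g * f \<in> face_ideal D"
    unfolding face_ideal_def
  proof (clarify elim!: keys_multE)
    fix a b assume "a \<in> keys g" "b \<in> keys f" "keys (a + b) \<in> D"
    then show False
      using f assms unfolding face_ideal_def down_closed_def keys_add_exponents by blast
  qed
qed (use keys_add in \<open>fastforce simp: face_ideal_def\<close>)+

lemma keys_indicator_exponent: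
  "keys (\<Sum>i\<in>F. Poly_Mapping.single i (1::nat)) = F" if "finite F"
  using that by (auto simp: in_keys_iff lookup_sum lookup_single when_def split: if_splits)

lemma prod_Var: "(\<Prod>i\<in>F. Var i) = (monomial (\<Sum>i\<in>F. Poly_Mapping.single i 1) :: ('v::finite, 'k::field) mpolynomial)"
proof (induction F rule: infinite_finite_induct)
  case (insert x F)
  then show ?case by (simp add: Var_def monomial_add)
qed (auto simp: monomial_def)

text \<open>The square-free monomial with support F detects whether F is a face. Complexes can thus
  be recovered from their ideals, which later allows repetitions of ideals to be removed at the
  level of faces.\<close>

lemma face_ideal_subset_imp:
  assumes "face_ideal D \<subseteq> (face_ideal E :: ('v::finite, 'k::field) mpolynomial set)"
  shows "E \<subseteq> D"
proof
  fix F assume F: "F \<in> E"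
  define m where "m = (\<Sum>i\<in>F. Poly_Mapping.single i (1::nat))"
  have m: "keys m = F" by (simp only: m_def keys_indicator_exponent finite)
  then have "(monomial m :: ('v, 'k) mpolynomial) \<notin> face_ideal E"
    using F by (simp add: monomial_mem_face_ideal)
  then have "(monomial m :: ('v, 'k) mpolynomial) \<notin> face_ideal D" using assms by blast
  then show "F \<in> D" using m by (simp add: monomial_mem_face_ideal)
qed

lemma face_ideal_eq_iff:
  "face_ideal D = (face_ideal E :: ('v::finite, 'k::field) mpolynomial set) \<longleftrightarrow> D = E"
  using face_ideal_subset_imp[of D E] face_ideal_subset_imp[of E D] by blast

lemma Var_mem_face_ideal: "(Var i :: ('v::finite, 'k::field) mpolynomial) \<in> face_ideal D \<longleftrightarrow> {i} \<notin> D"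
  by (simp add: Var_def monomial_mem_face_ideal)

text \<open>A monomial whose support is not contained in F is divisible by a variable outside
  F.\<close>

lemma face_prime_subsetI:
  assumes "ideal I (mpoly_ring :: ('v::finite, 'k::field) mpolynomial ring)"
    and "\<And>i. i \<notin> F \<Longrightarrow> Var i \<in> I"
  shows "face_ideal (Pow F) \<subseteq> I"
proof
  fix f :: "('v, 'k) mpolynomial" assume f: "f \<in> face_ideal (Pow F)"
  show "f \<in> I"
  proof (rule mem_ideal_of_monomials[OF assms(1)])
    fix m assume "m \<in> keys f"
    then obtain i where i: "i \<in> keys m" "i \<notin> F" using f by (auto simp: face_ideal_def)
    show "monomial m \<in> I"
    proof (rule monomial_multiple_mem_ideal[OF assms(1)])
      show "monomial (Poly_Mapping.single i 1) \<in> I" using assms(2)[OF i(2)] by (simp add: Var_def)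
      show "lookup (Poly_Mapping.single i 1) j \<le> lookup m j" for j
        using i(1) by (auto simp: lookup_single when_def in_keys_iff Suc_le_eq)
    qed
  qed
qed

text \<open>A monomial whose support misses the intersection already misses some \<open>D i\<close>,
  so it lies in one of the summands. Sums of ideals therefore turn into intersections of
  complexes.\<close>

lemma genideal_face_ideals:
  assumes D: "\<And>i. i \<in> A \<Longrightarrow> down_closed (D i :: 'v::finite set set)"
    and ne: "A \<noteq> {}"
  shows "genideal mpoly_ring (\<Union>i\<in>A. face_ideal (D i)) =
    (face_ideal (\<Inter>i\<in>A. D i) :: ('v, 'k::field) mpolynomial set)"
proof (rule genideal_mpoly_eqI)
  show "ideal (face_ideal (\<Inter>i\<in>A. D i)) (mpoly_ring :: ('v, 'k) mpolynomial ring)"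
    by (rule ideal_face_ideal) (use D in \<open>auto simp: down_closed_def\<close>)
  show "(\<Union>i\<in>A. face_ideal (D i)) \<subseteq> (face_ideal (\<Inter>i\<in>A. D i) :: ('v, 'k) mpolynomial set)"
    by (auto simp: face_ideal_def)
  fix K assume K: "ideal K (mpoly_ring :: ('v, 'k) mpolynomial ring)" "(\<Union>i\<in>A. face_ideal (D i)) \<subseteq> K"
  show "face_ideal (\<Inter>i\<in>A. D i) \<subseteq> K"
  proof
    fix f :: "('v, 'k) mpolynomial" assume f: "f \<in> face_ideal (\<Inter>i\<in>A. D i)"
    show "f \<in> K"
    proof (rule mem_ideal_of_monomials[OF K(1)])
      fix m assume "m \<in> keys f"
      then obtain i where "i \<in> A" "keys m \<notin> D i" using f by (auto simp: face_ideal_def)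
      then show "monomial m \<in> K" using K(2) monomial_mem_face_ideal by blast
    qed
  qed
qed

lemma set_add_face_ideals:
  assumes "down_closed (D :: 'v::finite set set)" "down_closed E"
  shows "face_ideal D <+>\<^bsub>mpoly_ring\<^esub> face_ideal E = (face_ideal (D \<inter> E) :: ('v, 'k::field) mpolynomial set)"
proof -
  have "face_ideal D <+>\<^bsub>mpoly_ring\<^esub> face_ideal E =
      genideal mpoly_ring (face_ideal D \<union> face_ideal E :: ('v, 'k) mpolynomial set)"
    using ring.union_genideal[OF ring_mpoly_ring ideal_face_ideal[OF assms(1)] ideal_face_ideal[OF assms(2)]]
    by (rule sym)
  also have "\<dots> = face_ideal (D \<inter> E)"
    proof -
    have "down_closed (if b then D else E)" for b using assms by simp
    then show ?thesis
      using genideal_face_ideals[of "{True, False}" "\<lambda>b. if b then D else E"]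
      by (simp add: Un_commute Int_commute)
  qed
  finally show ?thesis .
qed

lemma genideal_Var:
  "genideal mpoly_ring {Var i} = (face_ideal (Pow (- {i})) :: ('v::finite, 'k::field) mpolynomial set)"
proof (rule genideal_mpoly_eqI)
  fix K assume "ideal K (mpoly_ring :: ('v, 'k) mpolynomial ring)" "{Var i} \<subseteq> K"
  then show "face_ideal (Pow (- {i})) \<subseteq> K" by (intro face_prime_subsetI) auto
qed (auto simp: Var_mem_face_ideal intro!: ideal_face_ideal)

text \<open>Square-freeness makes membership a matter of supports: a generator with exponents at
  most 1 divides a monomial as soon as its support is contained in that of the monomial.\<close>

lemma squarefree_monomial_ideal_eq_face_ideal:
  assumes "squarefree_monomial_ideal (J :: ('v::finite, 'k::field) mpolynomial set)"
  shows "J = face_ideal (stanley_reisner_complex J)" and "down_closed (stanley_reisner_complex J)"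
proof -
  obtain G where G: "\<forall>m\<in>G. \<forall>i. lookup m i \<le> 1" "J = genideal mpoly_ring (monomial ` G)"
    using assms unfolding squarefree_monomial_ideal_def by blast
  define D where "D = {F. \<forall>g\<in>G. \<not> keys g \<subseteq> F}"
  have D: "down_closed D" by (auto simp: D_def down_closed_def)
  have J: "J = face_ideal D"
    unfolding G(2)
  proof (rule genideal_mpoly_eqI)
    fix K assume K: "ideal K (mpoly_ring :: ('v, 'k) mpolynomial ring)" "monomial ` G \<subseteq> K"
    show "face_ideal D \<subseteq> K"
    proof
      fix f :: "('v, 'k) mpolynomial" assume f: "f \<in> face_ideal D"
      show "f \<in> K"
      proof (rule mem_ideal_of_monomials[OF K(1)])
        fix m assume "m \<in> keys f"
        then obtain g where g: "g \<in> G" "keys g \<subseteq> keys m" using f by (auto simp: face_ideal_def D_def)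
        show "monomial m \<in> K"
        proof (rule monomial_multiple_mem_ideal[OF K(1)])
          show "monomial g \<in> K" using g K by auto
          show "lookup g j \<le> lookup m j" for j
          proof (cases "lookup g j = 0")
            case False
            then have "lookup m j \<noteq> 0" using g(2) by (metis in_keys_iff subsetD)
            then show ?thesis using G(1) g(1) by (meson le_trans less_one not_le)
          qed simp
        qed
      qed
    qed
  qed (use ideal_face_ideal[OF D] in \<open>auto simp: monomial_mem_face_ideal D_def\<close>)
  have "stanley_reisner_complex J = D"
    unfolding stanley_reisner_complex_def J
    by (auto simp: prod_Var monomial_mem_face_ideal keys_indicator_exponent[simplified])
  then show "J = face_ideal (stanley_reisner_complex J)" "down_closed (stanley_reisner_complex J)"
    using J D by auto
qed

text \<open>Filtering two finite sets of exponents by maximality in one variable after the other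
  leaves a lexicographically largest exponent in each of them; their sum is attained only once.\<close>

lemma sum_of_maximal_subsets:
  fixes A B :: "('v \<Rightarrow>\<^sub>0 nat) set"
  assumes "finite A" "A \<noteq> {}" "finite B" "B \<noteq> {}" "finite V"
  shows "\<exists>A' B'. A' \<noteq> {} \<and> A' \<subseteq> A \<and> B' \<noteq> {} \<and> B' \<subseteq> B \<and>
    (\<forall>x\<in>V. \<forall>a\<in>A'. \<forall>a'\<in>A'. lookup a x = lookup a' x) \<and>
    (\<forall>x\<in>V. \<forall>b\<in>B'. \<forall>b'\<in>B'. lookup b x = lookup b' x) \<and>
    (\<forall>a'\<in>A'. \<forall>b'\<in>B'. \<forall>a\<in>A. \<forall>b\<in>B. a + b = a' + b' \<longrightarrow> a \<in> A' \<and> b \<in> B')"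
  using assms(5)
proof (induction V rule: finite_induct)
  case empty
  then show ?case using assms by blast
next
  case (insert x V)
  from insert.IH obtain A' B' where AB: "A' \<noteq> {}" "A' \<subseteq> A" "B' \<noteq> {}" "B' \<subseteq> B"
    "\<forall>x\<in>V. \<forall>a\<in>A'. \<forall>a'\<in>A'. lookup a x = lookup a' x"
    "\<forall>x\<in>V. \<forall>b\<in>B'. \<forall>b'\<in>B'. lookup b x = lookup b' x"
    "\<forall>a'\<in>A'. \<forall>b'\<in>B'. \<forall>a\<in>A. \<forall>b\<in>B. a + b = a' + b' \<longrightarrow> a \<in> A' \<and> b \<in> B'"
    by (elim exE conjE) (rule that; assumption)
  have fin: "finite A'" "finite B'" using AB assms finite_subset by blast+
  define M where "M C = Max ((\<lambda>a. lookup a x) ` C)" for C :: "('v \<Rightarrow>\<^sub>0 nat) set"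
  define top where "top C = {a\<in>C. lookup a x = M C}" for C :: "('v \<Rightarrow>\<^sub>0 nat) set"
  have top_ne: "top C \<noteq> {}" if "finite C" "C \<noteq> {}" for C
  proof -
    have "M C \<in> (\<lambda>a. lookup a x) ` C" unfolding M_def using that by (intro Max_in) auto
    then show ?thesis unfolding top_def by force
  qed
  have M_ge: "lookup a x \<le> M C" if "finite C" "a \<in> C" for C a
    using that by (simp add: M_def)
  have "\<forall>a'\<in>top A'. \<forall>b'\<in>top B'. \<forall>a\<in>A. \<forall>b\<in>B. a + b = a' + b' \<longrightarrow> a \<in> top A' \<and> b \<in> top B'"
  proof (intro ballI impI)
    fix a' b' a b
    assume that: "a' \<in> top A'" "b' \<in> top B'" "a \<in> A" "b \<in> B" "a + b = a' + b'"
    have ab: "a \<in> A'" "b \<in> B'" using that AB(7) unfolding top_def by blast+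
    have "lookup a x + lookup b x = M A' + M B'"
      using arg_cong[OF that(5), of "\<lambda>m. lookup m x"] that(1,2) by (simp add: lookup_add top_def)
    then show "a \<in> top A' \<and> b \<in> top B'" using ab M_ge[OF fin(1) ab(1)] M_ge[OF fin(2) ab(2)] by (simp add: top_def)
  qed
  moreover have "\<forall>z\<in>insert x V. \<forall>a\<in>top A'. \<forall>a'\<in>top A'. lookup a z = lookup a' z"
    "\<forall>z\<in>insert x V. \<forall>a\<in>top B'. \<forall>a'\<in>top B'. lookup a z = lookup a' z"
    using AB(5,6) unfolding top_def by auto
  moreover have "top A' \<subseteq> A" "top B' \<subseteq> B" using AB(2,4) unfolding top_def by auto
  ultimately show ?case
    using top_ne[OF fin(1) AB(1)] top_ne[OF fin(2) AB(3)]
    by (intro exI[of _ "top A'"] exI[of _ "top B'"] conjI) assumption+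
qed

lemma unique_sum_exponents:
  fixes A B :: "('v::finite \<Rightarrow>\<^sub>0 nat) set"
  assumes "finite A" "A \<noteq> {}" "finite B" "B \<noteq> {}"
  obtains a b where "a \<in> A" "b \<in> B" "\<forall>a'\<in>A. \<forall>b'\<in>B. a' + b' = a + b \<longrightarrow> a' = a \<and> b' = b"
proof -
  from sum_of_maximal_subsets[OF assms finite[of UNIV]] obtain A' B' where AB:
    "A' \<noteq> {}" "A' \<subseteq> A" "B' \<noteq> {}" "B' \<subseteq> B"
    "\<forall>x\<in>UNIV. \<forall>a\<in>A'. \<forall>a'\<in>A'. lookup a x = lookup a' x"
    "\<forall>x\<in>UNIV. \<forall>b\<in>B'. \<forall>b'\<in>B'. lookup b x = lookup b' x"
    "\<forall>a'\<in>A'. \<forall>b'\<in>B'. \<forall>a\<in>A. \<forall>b\<in>B. a + b = a' + b' \<longrightarrow> a \<in> A' \<and> b \<in> B'"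
    by (elim exE conjE) (rule that; assumption)
  obtain a b where ab: "a \<in> A'" "b \<in> B'" using AB(1,3) by blast
  show ?thesis
  proof (rule that)
    show "a \<in> A" "b \<in> B" using ab AB(2,4) by blast+
    show "\<forall>a'\<in>A. \<forall>b'\<in>B. a' + b' = a + b \<longrightarrow> a' = a \<and> b' = b"
    proof (intro ballI impI)
      fix a' b' assume "a' \<in> A" "b' \<in> B" "a' + b' = a + b"
      then have "a' \<in> A'" "b' \<in> B'" using AB(7) ab by blast+
      then have "lookup a' x = lookup a x" "lookup b' x = lookup b x" for x using AB(5,6) ab by blast+
      then show "a' = a \<and> b' = b" by (blast intro: poly_mapping_eqI)
    qed
  qed
qed

text \<open>If neither factor lies in the ideal, both have monomials supported in F. Among these, a
  pair of exponents whose sum is attained only once gives a coefficient of the product that consists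
  of a single product of nonzero field elements, so nothing can cancel it.\<close>

lemma primeideal_face_ideal_Pow:
  "primeideal (face_ideal (Pow F) :: ('v::finite, 'k::field) mpolynomial set) mpoly_ring"
  unfolding primeideal_mpoly_iff
proof (intro conjI allI impI)
  show "ideal (face_ideal (Pow F) :: ('v, 'k) mpolynomial set) mpoly_ring"
    by (simp add: ideal_face_ideal)
  show "face_ideal (Pow F) \<noteq> (UNIV :: ('v, 'k) mpolynomial set)"
    using face_ideal_eq_iff[of "Pow F" "{}"] by auto
  fix f g :: "('v, 'k) mpolynomial"
  assume fg: "f * g \<in> face_ideal (Pow F)"
  show "f \<in> face_ideal (Pow F) \<or> g \<in> face_ideal (Pow F)"
  proof (rule ccontr)
    assume neg: "\<not> ?thesis"
    define A where "A = {m\<in>keys f. keys m \<subseteq> F}"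
    define B where "B = {m\<in>keys g. keys m \<subseteq> F}"
    have "finite A" "A \<noteq> {}" "finite B" "B \<noteq> {}"
      using neg by (auto simp: A_def B_def face_ideal_def)
    then obtain a b where ab: "a \<in> A" "b \<in> B"
      "\<forall>a'\<in>A. \<forall>b'\<in>B. a' + b' = a + b \<longrightarrow> a' = a \<and> b' = b"
      by (rule unique_sum_exponents)
    \<comment> \<open>Uniqueness extends from \<open>A\<close> and \<open>B\<close> to all exponents
      of f and g: exponents are nonnegative, so a sum supported in F has both summands supported in
      F.\<close>
    have uniq: "a' + b' = a + b \<longleftrightarrow> a' = a \<and> b' = b" if "a' \<in> keys f" "b' \<in> keys g" for a' b'
    proof
      assume eq: "a' + b' = a + b"
      have "keys (a' + b') \<subseteq> F"
        unfolding eq using ab(1,2) by (simp add: A_def B_def keys_add_exponents)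
      then have "keys a' \<union> keys b' \<subseteq> F" by (simp only: keys_add_exponents)
      then have "a' \<in> A" "b' \<in> B" using that by (auto simp: A_def B_def)
      then show "a' = a \<and> b' = b" using ab(3) eq by blast
    qed simp
    have "lookup (f * g) (a + b) =
        (\<Sum>a'\<in>keys f. \<Sum>b'\<in>keys g. if a' = a \<and> b' = b then lookup f a' * lookup g b' else 0)"
      unfolding lookup_mult_keys by (intro sum.cong refl) (simp add: uniq)
    also have "\<dots> = (\<Sum>a'\<in>keys f. if a' = a then lookup f a * lookup g b else 0)"
      using ab(2) by (intro sum.cong refl) (auto simp: B_def)
    also have "\<dots> = lookup f a * lookup g b" using ab(1) by (simp add: A_def)
    also have "\<dots> \<noteq> 0" using ab(1,2) by (simp add: A_def B_def in_keys_iff)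
    finally have "a + b \<in> keys (f * g)" by (simp add: in_keys_iff)
    moreover have "keys (a + b) \<subseteq> F" using ab by (simp add: A_def B_def keys_add_exponents)
    ultimately show False using fg by (auto simp: face_ideal_def)
  qed
qed

text \<open>If each ideal had an element outside P, the product of these elements would lie in the
  intersection but not in P.\<close>

lemma primeideal_finite_Inter:
  assumes "primeideal P (mpoly_ring :: ('v::finite, 'k::field) mpolynomial ring)"
    and "finite A" and "\<And>i. i \<in> A \<Longrightarrow> ideal (I i) mpoly_ring" and "(\<Inter>i\<in>A. I i) \<subseteq> P"
  shows "\<exists>i\<in>A. I i \<subseteq> P"
  using assms(2-)
proof (induction A rule: finite_induct)
  case empty
  then show ?case using assms(1) by (auto simp: primeideal_mpoly_iff)
next
  case (insert x A)
  show ?case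
  proof (rule ccontr)
    assume neg: "\<not> (\<exists>i\<in>insert x A. I i \<subseteq> P)"
    then have "\<not> (\<Inter>i\<in>A. I i) \<subseteq> P" using insert by blast
    then obtain b where b: "\<forall>i\<in>A. b \<in> I i" "b \<notin> P" by blast
    obtain a where a: "a \<in> I x" "a \<notin> P" using neg by blast
    have "a * b \<in> I i" if "i \<in> insert x A" for i
      using that a b insert.prems(1)[OF that] by (auto simp: ideal_mpoly_iff) (metis mult.commute)
    then have "a * b \<in> P" using insert.prems(2) by blast
    then show False using a b assms(1) by (auto simp: primeideal_mpoly_iff)
  qed
qed


section \<open>Heights of face primes\<close>

text \<open>Linear independence modulo an ideal takes the place of transcendence degree: if \<open>S\<close> is
  independent modulo a prime and \<open>f\<close> lies in that prime but not in a smaller one, then the products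
  \<open>f ^ a * s\<close> are independent modulo the smaller prime. Each step of a chain of primes thus
  multiplies the number of independent polynomials of bounded degree by the degree bound.\<close>

definition indep_mod :: "('v::finite, 'k::field) mpolynomial set \<Rightarrow> ('v, 'k) mpolynomial set \<Rightarrow> bool" where
  "indep_mod I S \<longleftrightarrow> (\<forall>c. (\<Sum>s\<in>S. Const (c s) * s) \<in> I \<longrightarrow> (\<forall>s\<in>S. c s = 0))"

text \<open>The bound is on each exponent separately and not on the total degree, so the admissible
  monomials form a box, whose size is an exact power.\<close>

definition exponents_le :: "nat \<Rightarrow> ('v::finite, 'k::field) mpolynomial \<Rightarrow> bool" where
  "exponents_le d f \<longleftrightarrow> (\<forall>m\<in>keys f. \<forall>i. lookup m i \<le> d)"

lemma Const_0 [simp]: "Const 0 = 0"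
  by (simp add: Const_def)

lemma exponents_le_mult:
  assumes "exponents_le d f" "exponents_le e g"
  shows "exponents_le (d + e) (f * g)"
  unfolding exponents_le_def
proof (intro ballI allI)
  fix m i assume "m \<in> keys (f * g)"
  then obtain a b where "a \<in> keys f" "b \<in> keys g" "m = a + b" by (rule keys_multE)
  then show "lookup m i \<le> d + e"
    using assms by (simp add: exponents_le_def lookup_add add_mono)
qed

lemma exponents_le_power:
  assumes "exponents_le d f"
  shows "exponents_le (a * d) (f ^ a)"
proof (induction a)
  case 0
  then show ?case by (simp add: exponents_le_def)
next
  case (Suc a)
  then show ?case using exponents_le_mult[OF assms Suc] by (simp add: add.commute)
qed

lemma exponents_le_mono: "exponents_le d f \<Longrightarrow> d \<le> e \<Longrightarrow> exponents_le e f"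
  by (auto simp: exponents_le_def intro: le_trans)

lemma ex_exponents_le:
  assumes "finite A"
  shows "\<exists>d. \<forall>f\<in>A. exponents_le d f"
proof -
  define E where "E = (\<Union>f\<in>A. \<Union>m\<in>keys f. range (lookup m))"
  have "finite E" using assms by (simp add: E_def)
  then have "\<forall>e\<in>E. e \<le> Max E" by simp
  then show ?thesis
    by (intro exI[of _ "Max E"]) (auto simp: exponents_le_def E_def)
qed

text \<open>Modulo Q only the term without f survives, so its coefficients vanish. What remains is
  divisible by f, and since f is not in the prime P this factor can be cancelled, which leaves a
  shorter sum of the same shape.\<close>

lemma indep_mod_power_sums:
  fixes f :: "('v::finite, 'k::field) mpolynomial"
  assumes "primeideal P mpoly_ring" "ideal Q mpoly_ring" "P \<subseteq> Q" "f \<in> Q" "f \<notin> P"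
    and "indep_mod Q S"
  shows "(\<Sum>a\<le>M. f ^ a * (\<Sum>s\<in>S. Const (c a s) * s)) \<in> P \<Longrightarrow> a \<le> M \<Longrightarrow> s \<in> S \<Longrightarrow> c a s = 0"
proof (induction M arbitrary: c a)
  case 0
  then have "(\<Sum>s\<in>S. Const (c 0 s) * s) \<in> Q" using assms(3) by auto
  then show ?case using 0 assms(6) by (auto simp: indep_mod_def)
next
  case (Suc M)
  define h where "h a = (\<Sum>s\<in>S. Const (c a s) * s)" for a
  define t where "t = (\<Sum>a\<le>M. f ^ a * h (Suc a))"
  have split: "(\<Sum>a\<le>Suc M. f ^ a * h a) = h 0 + t * f"
    unfolding t_def sum_distrib_right by (subst sum.atMost_Suc_shift) (simp add: ac_simps)
  have "(\<Sum>a\<le>Suc M. f ^ a * h a) \<in> P" using Suc.prems(1) by (simp only: h_def)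
  then have "h 0 + t * f \<in> P" by (simp only: split)
  moreover have "t * f \<in> Q" using assms(2,4) by (simp add: ideal_mpoly_iff)
  ultimately have "h 0 \<in> Q" using ideal_diff[OF assms(2), of "h 0 + t * f" "t * f"] assms(3) by auto
  then have c0: "\<forall>s\<in>S. c 0 s = 0" using assms(6) by (simp add: indep_mod_def h_def)
  then have "h 0 = 0" by (simp add: h_def)
  then have "t * f \<in> P" using \<open>h 0 + t * f \<in> P\<close> by simp
  then have "t \<in> P" using assms(1,5) by (auto simp: primeideal_mpoly_iff)
  then have "(\<Sum>a\<le>M. f ^ a * (\<Sum>s\<in>S. Const (c (Suc a) s) * s)) \<in> P" by (simp add: t_def h_def)
  then have "a' \<le> M \<Longrightarrow> c (Suc a') s = 0" for a'
    using Suc.IH[of "\<lambda>a. c (Suc a)" a'] Suc.prems(3) by blast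
  then show ?case using c0 Suc.prems(2,3) by (cases a) auto
qed

text \<open>Independence is formulated for sets, so the products must also be shown distinct to keep
  the count: a coincidence of two products would be a relation with coefficients 1 and -1.\<close>

lemma indep_mod_step:
  fixes f :: "('v::finite, 'k::field) mpolynomial"
  assumes P: "primeideal P mpoly_ring" "ideal Q mpoly_ring" "P \<subseteq> Q" "f \<in> Q" "f \<notin> P"
    and S: "finite S" "indep_mod Q S"
  defines "h \<equiv> (\<lambda>(a, s). f ^ a * s)"
  shows "inj_on h ({..M} \<times> S)" and "indep_mod P (h ` ({..M} \<times> S))"
proof -
  note zero = indep_mod_power_sums[OF P S(2)]
  have conv: "(\<Sum>x\<in>{..M} \<times> S. Const (c (fst x) (snd x)) * h x) =
      (\<Sum>a\<le>M. f ^ a * (\<Sum>s\<in>S. Const (c a s) * s))" for c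
    by (simp add: sum.cartesian_product' h_def case_prod_beta sum_distrib_left ac_simps)
  have P0: "0 \<in> P" using P(1) by (simp add: primeideal_mpoly_iff ideal_mpoly_iff)
  show inj: "inj_on h ({..M} \<times> S)"
  proof (rule inj_onI, rule ccontr)
    fix x y assume xy: "x \<in> {..M} \<times> S" "y \<in> {..M} \<times> S" "h x = h y" "x \<noteq> y"
    define c where "c a s = (if (a, s) = x then 1 else if (a, s) = y then -1 else (0::'k))" for a s
    have "(\<Sum>z\<in>{..M} \<times> S. Const (c (fst z) (snd z)) * h z) =
        (\<Sum>z\<in>{x, y}. Const (c (fst z) (snd z)) * h z)"
      using xy S(1) by (intro sum.mono_neutral_right) (auto simp: c_def)
    also have "\<dots> = 0"
      using xy(3,4) by (simp add: c_def Const_def single_uminus)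
    finally have "c (fst x) (snd x) = 0"
      using xy(1) P0 by (intro zero[of c M]) (auto simp: conv)
    then show False by (simp add: c_def)
  qed
  show "indep_mod P (h ` ({..M} \<times> S))"
    unfolding indep_mod_def
  proof (intro allI impI ballI)
    fix c z
    assume c: "(\<Sum>z\<in>h ` ({..M} \<times> S). Const (c z) * z) \<in> P" and z: "z \<in> h ` ({..M} \<times> S)"
    then obtain a s where as: "a \<le> M" "s \<in> S" "z = h (a, s)" by auto
    have "(\<Sum>a\<le>M. f ^ a * (\<Sum>s\<in>S. Const (c (h (a, s))) * s)) \<in> P"
      using c unfolding sum.reindex[OF inj] o_def conv[of "\<lambda>a s. c (h (a, s))", symmetric] by simp
    then show "c z = 0" using zero[of "\<lambda>a s. c (h (a, s))" M a s] as by simp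
  qed
qed

section \<open>Boxes of exponents and the size of independent sets\<close>

lemma bij_betw_exponents:
  "bij_betw (\<lambda>g. Abs_poly_mapping (\<lambda>i. if i \<in> F then g i else 0))
     (F \<rightarrow>\<^sub>E {..M}) {m :: 'v::finite \<Rightarrow>\<^sub>0 nat. keys m \<subseteq> F \<and> (\<forall>i. lookup m i \<le> M)}"
proof (rule bij_betw_byWitness[where f' = "\<lambda>m. restrict (lookup m) F"])
  show "\<forall>g\<in>F \<rightarrow>\<^sub>E {..M}. restrict (lookup (Abs_poly_mapping (\<lambda>i. if i \<in> F then g i else 0))) F = g"
    by (auto simp: fun_eq_iff PiE_def extensional_def)
  show "\<forall>m\<in>{m. keys m \<subseteq> F \<and> (\<forall>i. lookup m i \<le> M)}.
      Abs_poly_mapping (\<lambda>i. if i \<in> F then restrict (lookup m) F i else 0) = m"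
    by (auto intro!: poly_mapping_eqI simp: in_keys_iff subset_iff)
qed (auto simp: in_keys_iff split: if_splits)

lemma card_exponents:
  "card {m :: 'v::finite \<Rightarrow>\<^sub>0 nat. keys m \<subseteq> F \<and> (\<forall>i. lookup m i \<le> M)} = (M + 1) ^ card F"
  using bij_betw_same_card[OF bij_betw_exponents[of F M]] by (simp add: card_PiE)

lemma finite_exponents:
  "finite {m :: 'v::finite \<Rightarrow>\<^sub>0 nat. keys m \<subseteq> F \<and> (\<forall>i. lookup m i \<le> M)}"
  using bij_betw_finite[OF bij_betw_exponents[of F M]] by (simp add: finite_PiE)

lemma inj_monomial: "inj_on monomial A"
  by (rule inj_onI) (metis keys_monomial the_elem_eq)

text \<open>No element of the ideal has a monomial supported in F, so each coefficient of the
  combination must vanish. These monomials are the starting point of the growth count at the top of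
  a chain.\<close>

lemma indep_mod_face_prime:
  assumes "finite B" "\<And>m. m \<in> B \<Longrightarrow> keys m \<subseteq> F"
  shows "indep_mod (face_ideal (Pow F) :: ('v::finite, 'k::field) mpolynomial set) (monomial ` B)"
  unfolding indep_mod_def
proof (intro allI impI ballI)
  fix c :: "('v, 'k) mpolynomial \<Rightarrow> 'k" and s :: "('v, 'k) mpolynomial"
  assume c: "(\<Sum>s\<in>monomial ` B. Const (c s) * s) \<in> face_ideal (Pow F)" and "s \<in> monomial ` B"
  then obtain m where m: "m \<in> B" "s = monomial m" by auto
  define t :: "('v, 'k) mpolynomial" where "t = (\<Sum>s\<in>monomial ` B. Const (c s) * s)"
  have "t = (\<Sum>m\<in>B. Poly_Mapping.single m (c (monomial m)))"
    unfolding t_def sum.reindex[OF inj_monomial] by (simp add: Const_mult_monomial)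
  then have "lookup t m = c s"
    using m assms(1) by (simp add: lookup_sum lookup_single when_def)
  moreover have "m \<notin> keys t"
    using c assms(2)[OF m(1)] unfolding t_def[symmetric] face_ideal_def by blast
  ultimately show "c s = 0" by (simp add: in_keys_iff)
qed

interpretation mpoly: vector_space "\<lambda>a f :: ('v::finite, 'k::field) mpolynomial. Const a * f"
  by unfold_locales (simp_all add: Const_def algebra_simps single_add mult_single)

text \<open>Since 0 lies in I, independence modulo I implies linear independence, and the monomials
  of a box span all polynomials with exponents in that box.\<close>

lemma card_indep_mod_le:
  assumes "indep_mod I (S :: ('v::finite, 'k::field) mpolynomial set)" "0 \<in> I" "finite S"
    and "\<And>s. s \<in> S \<Longrightarrow> exponents_le d s"
  shows "card S \<le> (d + 1) ^ card (UNIV :: 'v set)"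
proof -
  define E where "E = {m :: 'v \<Rightarrow>\<^sub>0 nat. keys m \<subseteq> UNIV \<and> (\<forall>i. lookup m i \<le> d)}"
  have E: "finite E" "card E = (d + 1) ^ card (UNIV :: 'v set)"
    unfolding E_def by (rule finite_exponents, rule card_exponents)
  have "mpoly.independent S"
    unfolding mpoly.dependent_finite[OF assms(3)]
  proof clarify
    fix u v assume u: "v \<in> S" "u v \<noteq> 0" "(\<Sum>s\<in>S. Const (u s) * s) = 0"
    then have "(\<Sum>s\<in>S. Const (u s) * s) \<in> I" using assms(2) by simp
    then show False using assms(1) u(1,2) unfolding indep_mod_def by blast
  qed
  moreover have "S \<subseteq> mpoly.span (monomial ` E)"
  proof
    fix s assume "s \<in> S"
    then have "keys s \<subseteq> E" using assms(4) by (auto simp: exponents_le_def E_def)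
    then have "(\<Sum>m\<in>keys s. Const (lookup s m) * monomial m) \<in> mpoly.span (monomial ` E)"
      by (intro mpoly.span_sum mpoly.span_scale mpoly.span_base) auto
    then show "s \<in> mpoly.span (monomial ` E)"
      by (simp add: Const_mult_monomial flip: poly_eq_sum_single)
  qed
  ultimately have "card S \<le> card (monomial ` E :: ('v, 'k) mpolynomial set)"
    using mpoly.independent_span_bound[of "monomial ` E" S] E by simp
  also have "\<dots> = card E" by (rule card_image[OF inj_monomial])
  finally show ?thesis using E by simp
qed

text \<open>Going down the chain from the face prime, each step multiplies the number of independent
  polynomials by \<open>M + 1\<close> while the exponents grow only by the fixed amount
  \<open>M * D\<close>. A chain that is too long would produce more independent polynomials than
  there are monomials in the resulting box.\<close>

lemma chain_to_face_prime_length_le: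
  fixes C :: "nat \<Rightarrow> ('v::finite, 'k::field) mpolynomial set"
  assumes prime: "\<And>i. i \<le> n \<Longrightarrow> primeideal (C i) mpoly_ring"
    and strict: "\<And>i. i < n \<Longrightarrow> C i \<subset> C (Suc i)" and Cn: "C n = face_ideal (Pow F)"
  shows "n \<le> card (- F)"
proof (rule ccontr)
  assume "\<not> ?thesis"
  moreover have "card F + card (- F) = card (UNIV :: 'v set)"
    using card_Un_disjoint[of F "- F"] by (simp add: Compl_partition)
  ultimately have big: "card (UNIV :: 'v set) + 1 \<le> card F + n" by simp
  have ideal: "ideal (C i) mpoly_ring" if "i \<le> n" for i
    using prime[OF that] by (simp add: primeideal_mpoly_iff)
  have "\<forall>i. \<exists>f. i < n \<longrightarrow> f \<in> C (Suc i) - C i" using strict by blast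
  then obtain f where f: "\<And>i. i < n \<Longrightarrow> f i \<in> C (Suc i) - C i" by metis
  obtain D where D: "\<forall>g\<in>f ` {..<n}. exponents_le D g"
    using ex_exponents_le[of "f ` {..<n}"] by auto
  \<comment> \<open>The box has side at most \<open>(M + 1) * (n * D + 1)\<close>, so comparing it
    with the box of side \<open>M + 1\<close> costs the factor \<open>(n * D + 1)\<close> to the
    number of variables. Taking M equal to that factor makes the count come out as
    \<open>M + 1 \<le> M\<close>.\<close>
  define M where "M = (n * D + 1) ^ card (UNIV :: 'v set)"
  \<comment> \<open>Here i counts the steps taken downwards from \<open>C n\<close>; at i = n the
    bottom prime \<open>C 0\<close> is reached.\<close>
  have "\<exists>S. finite S \<and> indep_mod (C (n - i)) S \<and> card S = (M + 1) ^ (card F + i) \<and>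
      (\<forall>s\<in>S. exponents_le (M + i * (M * D)) s)" if "i \<le> n" for i
    using that
  proof (induction i)
    case 0
    define B where "B = {m :: 'v \<Rightarrow>\<^sub>0 nat. keys m \<subseteq> F \<and> (\<forall>i. lookup m i \<le> M)}"
    have "card (monomial ` B :: ('v, 'k) mpolynomial set) = (M + 1) ^ card F"
      unfolding B_def card_image[OF inj_monomial] by (rule card_exponents)
    moreover have B: "finite B" unfolding B_def by (rule finite_exponents)
    moreover have "indep_mod (C (n - 0)) (monomial ` B)"
      unfolding minus_nat.diff_0 Cn by (rule indep_mod_face_prime[OF B]) (simp add: B_def)
    moreover have "\<forall>s\<in>monomial ` B. exponents_le (M + 0 * (M * D)) (s :: ('v, 'k) mpolynomial)"
      by (auto simp: exponents_le_def B_def)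
    ultimately show ?case by (intro exI[of _ "monomial ` B"]) simp
  next
    case (Suc i)
    define j where "j = n - Suc i"
    have j: "j < n" "n - i = Suc j" using Suc.prems by (auto simp: j_def)
    obtain S where S: "finite S" "indep_mod (C (Suc j)) S" "card S = (M + 1) ^ (card F + i)"
      "\<forall>s\<in>S. exponents_le (M + i * (M * D)) s"
      using Suc.IH Suc.prems j(2) by auto
    define h where "h = (\<lambda>(a, s). f j ^ a * s)"
    have step: "inj_on h ({..M} \<times> S)" "indep_mod (C j) (h ` ({..M} \<times> S))"
      unfolding h_def
      using indep_mod_step[OF prime ideal _ _ _ S(1,2), of j "f j" M] j f[OF j(1)] strict[OF j(1)] by auto
    have "card (h ` ({..M} \<times> S)) = (M + 1) ^ (card F + Suc i)"
      using S(3) by (simp add: card_image[OF step(1)] card_cartesian_product)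
    moreover have "exponents_le (M + Suc i * (M * D)) s" if s: "s \<in> h ` ({..M} \<times> S)" for s
    proof -
      obtain a t where at: "a \<le> M" "t \<in> S" "s = f j ^ a * t" using s by (auto simp: h_def)
      have "exponents_le (a * D) (f j ^ a)" using D j by (intro exponents_le_power) auto
      then have "exponents_le (a * D + (M + i * (M * D))) s"
        unfolding at(3) using S(4) at(2) by (intro exponents_le_mult) auto
      then show ?thesis
        by (rule exponents_le_mono) (use at(1) in simp)
    qed
    ultimately show ?case
      using S(1) step(2) unfolding j_def by (intro exI[of _ "h ` ({..M} \<times> S)"]) auto
  qed
  from this[of n] obtain S where S: "finite S" "indep_mod (C 0) S" "card S = (M + 1) ^ (card F + n)"
      "\<forall>s\<in>S. exponents_le (M + n * (M * D)) s" by auto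
  have "(M + 1) ^ (card (UNIV :: 'v set) + 1) \<le> (M + 1) ^ (card F + n)"
    by (rule power_increasing[OF big]) simp
  also have "\<dots> \<le> (M + n * (M * D) + 1) ^ card (UNIV :: 'v set)"
    using card_indep_mod_le[OF S(2) _ S(1)] S(3,4) ideal[of 0] by (simp add: ideal_mpoly_iff)
  also have "\<dots> \<le> ((M + 1) * (n * D + 1)) ^ card (UNIV :: 'v set)"
    by (rule power_mono) (simp_all add: algebra_simps)
  also have "\<dots> = (M + 1) ^ card (UNIV :: 'v set) * M"
    unfolding power_mult_distrib M_def[symmetric] ..
  finally show False by simp
qed

text \<open>Starting from the zero ideal, the variables outside F are adjoined one at a time. Past
  the end of the list the chain is constant, so all its members are prime.\<close>

lemma chain_to_face_prime:
  obtains C :: "nat \<Rightarrow> ('v::finite, 'k::field) mpolynomial set"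
  where "\<forall>i. primeideal (C i) mpoly_ring" "\<forall>i<card (- F). C i \<subset> C (Suc i)"
    "C (card (- F)) = face_ideal (Pow F)"
proof -
  obtain xs where xs: "set xs = - F" "distinct xs" using finite_distinct_list[of "- F"] by auto
  then have len: "length xs = card (- F)" using distinct_card by metis
  define C :: "nat \<Rightarrow> ('v, 'k) mpolynomial set"
    where "C i = face_ideal (Pow (F \<union> set (drop i xs)))" for i
  have "C i \<subset> C (Suc i)" if "i < card (- F)" for i
  proof -
    have drop: "drop i xs = xs ! i # drop (Suc i) xs"
      using that len by (simp add: Cons_nth_drop_Suc)
    have "distinct (drop i xs)" using xs(2) by simp
    then have "xs ! i \<notin> set (drop (Suc i) xs)" by (simp add: drop)
    moreover have "xs ! i \<notin> F" using that len xs(1) nth_mem[of i xs] by auto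
    ultimately have "F \<union> set (drop i xs) \<noteq> F \<union> set (drop (Suc i) xs)" by (auto simp: drop)
    then have "C i \<noteq> C (Suc i)" unfolding C_def face_ideal_eq_iff by (simp add: Pow_def) blast
    moreover have "C i \<subseteq> C (Suc i)"
      unfolding C_def by (rule face_ideal_antimono) (auto simp: drop)
    ultimately show ?thesis by blast
  qed
  moreover have "C (card (- F)) = face_ideal (Pow F)" by (simp add: C_def flip: len)
  ultimately show ?thesis using that[of C] primeideal_face_ideal_Pow unfolding C_def by blast
qed

lemma height_face_prime:
  "height mpoly_ring (face_ideal (Pow F) :: ('v::finite, 'k::field) mpolynomial set) = enat (card (- F))"
  unfolding height_def
proof (rule antisym)
  show "Sup {enat n |n. \<exists>C :: nat \<Rightarrow> ('v, 'k) mpolynomial set. (\<forall>i\<le>n. primeideal (C i) mpoly_ring) \<and>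
      (\<forall>i<n. C i \<subset> C (Suc i)) \<and> C n = face_ideal (Pow F)} \<le> enat (card (- F))"
  proof (rule Sup_least, clarify)
    fix n and C :: "nat \<Rightarrow> ('v, 'k) mpolynomial set"
    assume C: "\<forall>i\<le>n. primeideal (C i) mpoly_ring" "\<forall>i<n. C i \<subset> C (Suc i)" "C n = face_ideal (Pow F)"
    have "n \<le> card (- F)"
      by (rule chain_to_face_prime_length_le[of n C, OF _ _ C(3)]) (use C in blast)+
    then show "enat n \<le> enat (card (- F))" by simp
  qed
  obtain C :: "nat \<Rightarrow> ('v, 'k) mpolynomial set"
    where "\<forall>i. primeideal (C i) mpoly_ring" "\<forall>i<card (- F). C i \<subset> C (Suc i)"
    "C (card (- F)) = face_ideal (Pow F)" by (rule chain_to_face_prime[of F])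
  then show "enat (card (- F)) \<le> Sup {enat n |n. \<exists>C :: nat \<Rightarrow> ('v, 'k) mpolynomial set.
      (\<forall>i\<le>n. primeideal (C i) mpoly_ring) \<and> (\<forall>i<n. C i \<subset> C (Suc i)) \<and> C n = face_ideal (Pow F)}"
    by (intro Sup_upper) auto
qed

text \<open>A chain ending in P becomes a chain of the same length ending in Q when its last member
  is replaced. Hence the codimension of a prime, a minimum over all primes containing it, is its own
  height.\<close>

lemma height_mono:
  assumes "primeideal Q R" "P \<subseteq> Q"
  shows "height R P \<le> height R Q"
  unfolding height_def
proof (rule Sup_mono, clarify)
  fix n and C :: "nat \<Rightarrow> 'a set"
  assume C: "\<forall>i\<le>n. primeideal (C i) R" "\<forall>i<n. C i \<subset> C (Suc i)" "P = C n"
  define C' where "C' = C(n := Q)"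
  have "(\<forall>i\<le>n. primeideal (C' i) R) \<and> (\<forall>i<n. C' i \<subset> C' (Suc i)) \<and> C' n = Q"
    using C assms by (auto simp: C'_def)
  then show "\<exists>a\<in>{enat n |n. \<exists>C :: nat \<Rightarrow> 'a set. (\<forall>i\<le>n. primeideal (C i) R) \<and>
      (\<forall>i<n. C i \<subset> C (Suc i)) \<and> C n = Q}. enat n \<le> a"
    by blast
qed

lemma codim_face_prime:
  "codim mpoly_ring (face_ideal (Pow F) :: ('v::finite, 'k::field) mpolynomial set) = enat (card (- F))"
  unfolding codim_def height_face_prime[symmetric, where 'k = 'k]
  by (rule antisym) (auto intro!: INF_lower INF_greatest height_mono simp: primeideal_face_ideal_Pow)


section \<open>Hilbert functions of face ideals\<close>

lemma subfield_Const: "subfield (range Const) (mpoly_ring :: ('v::finite, 'k::field) mpolynomial ring)"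
proof -
  interpret cring "mpoly_ring :: ('v, 'k) mpolynomial ring" by (rule cring_mpoly_ring)
  have mult: "Const a * Const b = (Const (a * b) :: ('v, 'k) mpolynomial)" for a b
    by (simp add: Const_def mult_single)
  have zero: "(Const a :: ('v, 'k) mpolynomial) = 0 \<longleftrightarrow> a = 0" for a
    by (metis Const_0 Const_def lookup_single_eq lookup_zero)
  have one: "(Const 1 :: ('v, 'k) mpolynomial) = 1" by (simp add: Const_def)
  show ?thesis
  proof (rule subfieldI)
    have "subring (range Const) (mpoly_ring :: ('v, 'k) mpolynomial ring)"
    proof (rule subringI)
      show "\<one>\<^bsub>mpoly_ring\<^esub> \<in> range (Const :: 'k \<Rightarrow> ('v, 'k) mpolynomial)" using one by (metis mpoly_ring_simps(4) rangeI)
      fix x y :: "('v, 'k) mpolynomial" assume "x \<in> range Const" "y \<in> range Const"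
      then obtain a b where ab: "x = Const a" "y = Const b" by auto
      show "x \<otimes>\<^bsub>mpoly_ring\<^esub> y \<in> range Const" by (simp add: ab mult)
      have "x + y = Const (a + b)" by (simp add: ab Const_def single_add)
      then show "x \<oplus>\<^bsub>mpoly_ring\<^esub> y \<in> range Const" by simp
    next
      fix x :: "('v, 'k) mpolynomial" assume "x \<in> range Const"
      then obtain a where "x = Const a" by auto
      then have "- x = Const (- a)" by (simp add: Const_def single_uminus)
      then show "\<ominus>\<^bsub>mpoly_ring\<^esub> x \<in> range Const" by simp
    qed simp
    then show "subcring (range Const) (mpoly_ring :: ('v, 'k) mpolynomial ring)"
      by (rule subcringI')
    show "Units (mpoly_ring\<lparr>carrier := range Const\<rparr>) =
        range Const - {\<zero>\<^bsub>mpoly_ring :: ('v, 'k) mpolynomial ring\<^esub>}" (is "?U = ?R")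
    proof (rule Set.set_eqI)
      fix x :: "('v, 'k) mpolynomial"
      have "x \<in> ?U \<longleftrightarrow> (\<exists>a. x = Const a \<and> (\<exists>b. Const b * x = 1 \<and> x * Const b = 1))"
        by (auto simp: Units_def)
      also have "\<dots> \<longleftrightarrow> (\<exists>a. x = Const a \<and> a \<noteq> 0)"
      proof (intro ex_cong1 conj_cong refl)
        fix a assume x: "x = Const a"
        show "(\<exists>b. Const b * x = 1 \<and> x * Const b = 1) \<longleftrightarrow> a \<noteq> 0"
        proof
          assume "\<exists>b. Const b * x = 1 \<and> x * Const b = 1"
          then show "a \<noteq> 0" using x by auto
        next
          assume "a \<noteq> 0"
          then show "\<exists>b. Const b * x = 1 \<and> x * Const b = 1"
            by (intro exI[of _ "inverse a"]) (simp add: x mult one)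
        qed
      qed
      also have "\<dots> \<longleftrightarrow> x \<in> ?R" using zero by auto
      finally show "x \<in> ?U \<longleftrightarrow> x \<in> ?R" .
    qed
  qed
qed

lemma coset_eq_iff:
  assumes "ideal I (mpoly_ring :: ('v::finite, 'k::field) mpolynomial ring)"
  shows "I +>\<^bsub>mpoly_ring\<^esub> f = I +>\<^bsub>mpoly_ring\<^esub> g \<longleftrightarrow> f - g \<in> I"
  using ring.quotient_eq_iff_same_a_r_cos[OF ring_mpoly_ring assms, of f g]
  by (simp add: a_minus_def)

text \<open>Dropping the terms supported on nonfaces changes a polynomial by an element of the
  ideal, so the monomials supported on faces suffice as representatives.\<close>

lemma graded_part_coset:
  assumes "down_closed (D :: 'v::finite set set)"
  shows "(+>\<^bsub>mpoly_ring\<^esub>) (face_ideal D) ` graded_part \<delta> v =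
    (+>\<^bsub>mpoly_ring\<^esub>) (face_ideal D :: ('v, 'k::field) mpolynomial set) `
      {f. keys f \<subseteq> {m. keys m \<in> D \<and> multidegree \<delta> m = v}}" (is "?c ` ?A = ?c ` ?B")
proof
  show "?c ` ?B \<subseteq> ?c ` ?A" by (rule image_mono) (auto simp: graded_part_def)
  show "?c ` ?A \<subseteq> ?c ` ?B"
  proof (rule image_subsetI)
    fix f :: "('v, 'k) mpolynomial" assume f: "f \<in> ?A"
    define g where "g = (\<Sum>m\<in>{m\<in>keys f. keys m \<in> D}. Poly_Mapping.single m (lookup f m))"
    have g: "lookup g m = (if keys m \<in> D then lookup f m else 0)" for m
      by (auto simp: g_def lookup_sum lookup_single when_def in_keys_iff)
    have "f - g \<in> face_ideal D"
      unfolding face_ideal_def by (auto simp: in_keys_iff lookup_minus g)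
    then have "?c f = ?c g" using coset_eq_iff[OF ideal_face_ideal[OF assms]] by blast
    moreover have "g \<in> ?B"
      using f by (auto simp: in_keys_iff g graded_part_def split: if_splits)
    ultimately show "?c f \<in> ?c ` ?B" by blast
  qed
qed

text \<open>Each further monomial is one application of \<open>Suc_dim\<close>. Its coset is new
  because subtracting a combination of the other monomials leaves a polynomial that still contains
  this monomial, whose support is a face.\<close>

lemma dimension_quotient_face_ideal:
  assumes D: "down_closed (D :: 'v::finite set set)"
  defines "I \<equiv> (face_ideal D :: ('v, 'k::field) mpolynomial set)"
  defines "K \<equiv> range (\<lambda>a. I +>\<^bsub>mpoly_ring\<^esub> Const a)"
  shows "distinct ms \<Longrightarrow> (\<And>m. m \<in> set ms \<Longrightarrow> keys m \<in> D) \<Longrightarrow>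
    ring.dimension (mpoly_ring Quot I) (length ms) K ((+>\<^bsub>mpoly_ring\<^esub>) I ` {f. keys f \<subseteq> set ms})"
proof (induction ms)
  interpret I: ideal I mpoly_ring unfolding I_def by (rule ideal_face_ideal[OF D])
  interpret Q: ring "mpoly_ring Quot I" by (rule I.quotient_is_ring)
  interpret h: ring_hom_ring mpoly_ring "mpoly_ring Quot I" "(+>\<^bsub>mpoly_ring\<^esub>) I"
    by (rule I.rcos_ring_hom_ring)
  note eq = coset_eq_iff[OF I.ideal_axioms]
  {
    case Nil
    have "(+>\<^bsub>mpoly_ring\<^esub>) I ` {f. keys f \<subseteq> set []} = {\<zero>\<^bsub>mpoly_ring Quot I\<^esub>}"
      using h.hom_zero by simp
    then show ?case using Q.zero_dim by simp
  next
    case (Cons m ms)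
    let ?E = "(+>\<^bsub>mpoly_ring\<^esub>) I ` {f. keys f \<subseteq> set ms}"
    let ?u = "I +>\<^bsub>mpoly_ring\<^esub> monomial m"
    have IH: "Q.dimension (length ms) K ?E" using Cons by simp
    have u: "?u \<in> carrier (mpoly_ring Quot I)" using h.hom_closed[of "monomial m"] by simp
    have "?u \<notin> ?E"
    proof
      assume "?u \<in> ?E"
      then obtain f where f: "keys f \<subseteq> set ms" "monomial m - f \<in> I" using eq by blast
      have "m \<notin> keys f" using f(1) Cons.prems(1) by auto
      then have "m \<in> keys (monomial m - f)"
        by (simp add: in_keys_iff lookup_minus monomial_def)
      then show False using f(2) Cons.prems(2)[of m] by (auto simp: I_def face_ideal_def)
    qed
    from Q.Suc_dim[OF u this IH]
    have dim: "Q.dimension (Suc (length ms)) K (Q.line_extension K ?u ?E)" .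
    have "Q.line_extension K ?u ?E =
        (\<Union>a. \<Union>f\<in>{f. keys f \<subseteq> set ms}. {I +>\<^bsub>mpoly_ring\<^esub> (Const a * monomial m + f)})"
    proof -
      have "(I +>\<^bsub>mpoly_ring\<^esub> Const a) \<otimes>\<^bsub>mpoly_ring Quot I\<^esub> ?u \<oplus>\<^bsub>mpoly_ring Quot I\<^esub> (I +>\<^bsub>mpoly_ring\<^esub> f) =
          I +>\<^bsub>mpoly_ring\<^esub> (Const a * monomial m + f)" for a f
        using h.hom_mult[of "Const a" "monomial m"] h.hom_add[of "Const a * monomial m" f] by simp
      then show ?thesis
        unfolding Q.line_extension_def set_add_def' r_coset_def K_def by auto
    qed
    also have "\<dots> = (+>\<^bsub>mpoly_ring\<^esub>) I ` {f. keys f \<subseteq> set (m # ms)}"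
    proof -
      have fwd: "keys (Const a * monomial m + f) \<subseteq> set (m # ms)" if "keys f \<subseteq> set ms"
        for a and f :: "('v, 'k) mpolynomial"
        using that keys_add[of "Poly_Mapping.single m a" f] keys_single[of m a]
        unfolding Const_mult_monomial by (auto split: if_splits)
      have bwd: "\<exists>a g. f = Const a * monomial m + g \<and> keys g \<subseteq> set ms"
        if "keys f \<subseteq> set (m # ms)" for f :: "('v, 'k) mpolynomial"
      proof (intro exI conjI)
        define g where "g = f - Const (lookup f m) * monomial m"
        show "f = Const (lookup f m) * monomial m + g" by (simp add: g_def)
        show "keys g \<subseteq> set ms"
        proof
          fix m' assume "m' \<in> keys g"
          then have "lookup f m' - lookup (Poly_Mapping.single m (lookup f m)) m' \<noteq> 0"
            by (simp add: g_def Const_mult_monomial in_keys_iff lookup_minus)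
          then have "m' \<noteq> m" "m' \<in> keys f"
            by (auto simp: lookup_single when_def in_keys_iff split: if_splits)
          then show "m' \<in> set ms" using that by auto
        qed
      qed
      have "{f :: ('v, 'k) mpolynomial. keys f \<subseteq> set (m # ms)} =
          (\<Union>a. (\<lambda>f. Const a * monomial m + f) ` {f. keys f \<subseteq> set ms})" (is "?L = ?R")
      proof (intro equalityI subsetI)
        fix f :: "('v, 'k) mpolynomial" assume "f \<in> ?L"
        then have "keys f \<subseteq> set (m # ms)" by (rule CollectD)
        from bwd[OF this] show "f \<in> ?R" by blast
      next
        fix f :: "('v, 'k) mpolynomial" assume "f \<in> ?R"
        then obtain a g where "f = Const a * monomial m + g" "keys g \<subseteq> set ms" by blast
        then show "f \<in> ?L" using fwd by blast
      qed
      then show ?thesis by (simp only: image_UN image_image) blast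
    qed
    finally show ?case using dim by simp
  }
qed

text \<open>\<open>ring.dim\<close> is a definite description, so a basis alone does not determine
  it: uniqueness of the dimension has to be established too.\<close>

lemma hilbert_function_face_ideal:
  assumes D: "down_closed (D :: 'v::finite set set)"
    and fin: "finite {m. keys m \<in> D \<and> multidegree \<delta> m = v}"
  shows "hilbert_function \<delta> (face_ideal D :: ('v, 'k::field) mpolynomial set) v =
    card {m. keys m \<in> D \<and> multidegree \<delta> m = v}"
proof -
  define I where "I = (face_ideal D :: ('v, 'k) mpolynomial set)"
  define K where "K = range (\<lambda>a. I +>\<^bsub>mpoly_ring\<^esub> Const a)"
  interpret I: ideal I mpoly_ring unfolding I_def by (rule ideal_face_ideal[OF D])
  interpret Q: ring "mpoly_ring Quot I" by (rule I.quotient_is_ring)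
  interpret h: ring_hom_ring mpoly_ring "mpoly_ring Quot I" "(+>\<^bsub>mpoly_ring\<^esub>) I"
    by (rule I.rcos_ring_hom_ring)
  obtain ms where ms: "set ms = {m. keys m \<in> D \<and> multidegree \<delta> m = v}" "distinct ms"
    using finite_distinct_list[OF fin] by auto
  define E where "E = (+>\<^bsub>mpoly_ring\<^esub>) I ` graded_part \<delta> v"
  have dim: "Q.dimension (length ms) K E"
    using dimension_quotient_face_ideal[OF D ms(2), where 'k = 'k] ms(1)
    unfolding E_def I_def graded_part_coset[OF D] K_def by auto
  have uniq: "n = length ms" if n: "Q.dimension n K E" for n
  proof (cases "D = {}")
    \<comment> \<open>The quotient is the zero ring, where the scalars do not form a field. There
      every subspace contains 0, the only element, so no vector is available for an application of
      \<open>Suc_dim\<close> and the dimension must be 0.\<close>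
    case True
    then have I: "I = UNIV" by (simp add: I_def)
    have carrier: "x = \<zero>\<^bsub>mpoly_ring Quot I\<^esub>" if "x \<in> carrier (mpoly_ring Quot I)" for x
    proof -
      obtain f where "x = I +>\<^bsub>mpoly_ring\<^esub> f"
        using \<open>x \<in> carrier (mpoly_ring Quot I)\<close> unfolding FactRing_def A_RCOSETS_def' by auto
      then show ?thesis using coset_eq_iff[OF I.ideal_axioms, of f 0] h.hom_zero by (simp add: I)
    qed
    have zero_mem: "\<zero>\<^bsub>mpoly_ring Quot I\<^esub> \<in> E'"
      if "Q.dimension k K' E'" "\<zero>\<^bsub>mpoly_ring Quot I\<^esub> \<in> K'" for k K' E'
      using that
    proof (induction rule: Q.dimension.induct)
      case (Suc_dim v E n K)
      have "\<zero>\<^bsub>mpoly_ring Quot I\<^esub> \<otimes>\<^bsub>mpoly_ring Quot I\<^esub> v \<oplus>\<^bsub>mpoly_ring Quot I\<^esub> \<zero>\<^bsub>mpoly_ring Quot I\<^esub>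
          \<in> Q.line_extension K v E"
        unfolding Q.line_extension_def set_add_def' r_coset_def using Suc_dim by blast
      then show ?case using Suc_dim(1) by simp
    qed simp
    have K: "\<zero>\<^bsub>mpoly_ring Quot I\<^esub> \<in> K"
      using h.hom_zero unfolding K_def by (intro image_eqI[of _ _ 0]) simp_all
    have zero: "k = 0" if k: "Q.dimension k K E" for k
      using k
    proof (cases rule: Q.dimension.cases)
      case (Suc_dim v E' n)
      then show ?thesis using carrier[of v] zero_mem[OF _ K, of n E'] by simp
    qed simp
    show ?thesis using zero[OF n] zero[OF dim] by simp
  next
    case False
    then have "{} \<in> D" using D by (auto simp: down_closed_def)
    then have "(1 :: ('v, 'k) mpolynomial) \<notin> I" by (simp add: I_def face_ideal_def)
    then have "\<one>\<^bsub>mpoly_ring Quot I\<^esub> \<noteq> \<zero>\<^bsub>mpoly_ring Quot I\<^esub>"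
      using coset_eq_iff[OF I.ideal_axioms, of 1 0] h.hom_one h.hom_zero by simp
    then have "subfield ((+>\<^bsub>mpoly_ring\<^esub>) I ` range Const) (mpoly_ring Quot I)"
      by (rule h.img_is_subfield(2)[OF subfield_Const])
    then have "subfield K (mpoly_ring Quot I)" by (simp add: K_def image_image)
    then show ?thesis using Q.dimension_is_inj[OF _ n dim] by blast
  qed
  have "Q.dim K E = length ms"
    unfolding Q.dim_def by (rule the_equality, rule dim, rule uniq)
  then show ?thesis
    using distinct_card[OF ms(2)] unfolding ms(1)
    by (simp add: hilbert_function_def I_def[symmetric] K_def[symmetric] E_def[symmetric])
qed


section \<open>Hilbert polynomials of face ideals\<close>

definition monomial_value :: "('p::finite \<Rightarrow> nat) \<Rightarrow> ('p \<Rightarrow>\<^sub>0 nat) \<Rightarrow> rat" where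
  "monomial_value v m = (\<Prod>l\<in>UNIV. of_nat (v l) ^ lookup m l)"

lemma eval_poly_superset:
  assumes "finite A" "keys P \<subseteq> A"
  shows "eval_poly P v = (\<Sum>m\<in>A. lookup P m * monomial_value v m)"
  unfolding eval_poly_def monomial_value_def
  by (rule sum.mono_neutral_left) (use assms in \<open>auto simp: in_keys_iff\<close>)

lemma eval_poly_0 [simp]: "eval_poly 0 v = 0"
  by (simp add: eval_poly_def)

lemma eval_poly_single: "eval_poly (Poly_Mapping.single m c) v = c * monomial_value v m"
  by (subst eval_poly_superset[of "{m}"]) (auto split: if_splits)

lemma eval_poly_add: "eval_poly (P + Q) v = eval_poly P v + eval_poly Q v"
  using keys_add[of P Q]
  by (simp add: eval_poly_superset[of "keys P \<union> keys Q"] lookup_add distrib_right sum.distrib)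

lemma eval_poly_sum: "eval_poly (\<Sum>i\<in>A. P i) v = (\<Sum>i\<in>A. eval_poly (P i) v)"
  by (induction A rule: infinite_finite_induct) (simp_all add: eval_poly_add)

lemma eval_poly_diff: "eval_poly (P - Q) v = eval_poly P v - eval_poly Q v"
  using eval_poly_add[of "P - Q" Q v] by simp

lemma monomial_value_add: "monomial_value v (a + b) = monomial_value v a * monomial_value v b"
  by (simp add: monomial_value_def lookup_add power_add prod.distrib)

lemma eval_poly_mult: "eval_poly (P * Q) v = eval_poly P v * eval_poly Q v"
proof -
  have "eval_poly (P * Q) v =
      (\<Sum>a\<in>keys P. \<Sum>b\<in>keys Q. eval_poly (Poly_Mapping.single (a + b) (lookup P a * lookup Q b)) v)"
    by (subst (1) poly_eq_sum_single[of P], subst (1) poly_eq_sum_single[of Q])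
       (simp only: sum_product mult_single eval_poly_sum)
  also have "\<dots> = eval_poly P v * eval_poly Q v"
    unfolding eval_poly_superset[OF finite_keys order_refl, of P] eval_poly_superset[OF finite_keys order_refl, of Q]
      sum_product by (simp add: eval_poly_single monomial_value_add ac_simps)
  finally show ?thesis .
qed

text \<open>A polynomial vanishing on a translated orthant is zero, by induction on the variables: for
  fixed values of the others it is a univariate polynomial with infinitely many zeros.\<close>

lemma vanishing_coefficients:
  fixes c :: "('p::finite \<Rightarrow>\<^sub>0 nat) \<Rightarrow> rat"
  assumes "finite A" "finite M"
    and "\<And>m m'. m \<in> M \<Longrightarrow> m' \<in> M \<Longrightarrow> \<forall>l\<in>A. lookup m l = lookup m' l \<Longrightarrow> m = m'"
    and "\<And>v. \<forall>l. N \<le> v l \<Longrightarrow> (\<Sum>m\<in>M. c m * (\<Prod>l\<in>A. of_nat (v l) ^ lookup m l)) = 0"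
    and "m0 \<in> M"
  shows "c m0 = 0"
  using assms
proof (induction A arbitrary: M rule: finite_induct)
  case empty
  then have "M = {m0}" by auto
  then show ?case using empty.prems(3)[of "\<lambda>_. N"] by simp
next
  case (insert a A)
  define M' where "M' = {m\<in>M. lookup m a = lookup m0 a}"
  show ?case
  proof (rule insert.IH[of M'])
    show "finite M'" "m0 \<in> M'" using insert.prems by (auto simp: M'_def)
    show "m = m'" if "m \<in> M'" "m' \<in> M'" "\<forall>l\<in>A. lookup m l = lookup m' l" for m m'
      using insert.prems(2)[of m m'] that by (simp add: M'_def)
    fix v :: "'p \<Rightarrow> nat" assume v: "\<forall>l. N \<le> v l"
    define r where "r m = c m * (\<Prod>l\<in>A. of_nat (v l) ^ lookup m l)" for m
    define q :: "rat poly" where "q = (\<Sum>m\<in>M. monom (r m) (lookup m a))"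
    have "poly q (of_nat t) = 0" if "N \<le> t" for t
    proof -
      have "(\<Prod>l\<in>A. of_nat ((v(a := t)) l) ^ lookup m l) = (\<Prod>l\<in>A. (of_nat (v l) :: rat) ^ lookup m l)" for m
        using insert.hyps(2) by (intro prod.cong) auto
      then have "poly q (of_nat t) =
          (\<Sum>m\<in>M. c m * (\<Prod>l\<in>insert a A. of_nat ((v(a := t)) l) ^ lookup m l))"
        using insert.hyps by (simp add: q_def r_def poly_sum poly_monom ac_simps)
      also have "\<dots> = 0" using insert.prems(3)[of "v(a := t)"] v that by simp
      finally show ?thesis .
    qed
    then have "of_nat ` {N..} \<subseteq> {x. poly q x = 0}" by auto
    moreover have "infinite (of_nat ` {N..} :: rat set)"
    proof
      assume "finite (of_nat ` {N..} :: rat set)"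
      then have "finite {N..}" by (rule finite_imageD) (simp add: inj_on_def)
      then show False by (simp add: infinite_Ici)
    qed
    ultimately have "q = 0" using poly_roots_finite[of q] finite_subset by blast
    then have "0 = coeff q (lookup m0 a)" by simp
    also have "\<dots> = (\<Sum>m\<in>M. if lookup m a = lookup m0 a then r m else 0)"
      by (simp add: q_def coeff_sum)
    also have "\<dots> = (\<Sum>m\<in>M'. r m)"
      using insert.prems(1) by (simp add: M'_def sum.inter_filter)
    finally show "(\<Sum>m\<in>M'. c m * (\<Prod>l\<in>A. of_nat (v l) ^ lookup m l)) = 0" by (simp add: r_def)
  qed
qed

text \<open>This is the property under the description operator in
  \<open>hilbert_polynomial\<close>, stated for arbitrary functions so that polynomials can be
  assembled from sums and products.\<close>

definition agrees_with_poly :: "(('p::finite \<Rightarrow> nat) \<Rightarrow> rat) \<Rightarrow> (('p \<Rightarrow>\<^sub>0 nat) \<Rightarrow>\<^sub>0 rat) \<Rightarrow> bool" where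
  "agrees_with_poly f P \<longleftrightarrow> (\<exists>N. \<forall>v. (\<forall>l. N \<le> v l) \<longrightarrow> eval_poly P v = f v)"

lemma agrees_with_poly_unique:
  assumes "agrees_with_poly f P" "agrees_with_poly f Q"
  shows "P = Q"
proof -
  obtain N N' where N: "\<forall>v. (\<forall>l. N \<le> v l) \<longrightarrow> eval_poly P v = f v"
    "\<forall>v. (\<forall>l. N' \<le> v l) \<longrightarrow> eval_poly Q v = f v"
    using assms unfolding agrees_with_poly_def by blast
  have "lookup (P - Q) m = 0" if m: "m \<in> keys (P - Q)" for m
  proof (rule vanishing_coefficients[of UNIV "keys (P - Q)" "max N N'" "lookup (P - Q)"])
    fix v :: "'a \<Rightarrow> nat" assume "\<forall>l. max N N' \<le> v l"
    then have "eval_poly (P - Q) v = 0" using N by (simp add: eval_poly_diff)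
    then show "(\<Sum>m\<in>keys (P - Q). lookup (P - Q) m * (\<Prod>l\<in>UNIV. of_nat (v l) ^ lookup m l)) = 0"
      by (simp add: eval_poly_def)
  qed (use m in \<open>auto intro: poly_mapping_eqI\<close>)
  then have "keys (P - Q) = {}" by (meson equals0I in_keys_iff)
  then show ?thesis by simp
qed

lemma agrees_with_poly_combine:
  assumes "agrees_with_poly f P" "agrees_with_poly g Q"
    and "\<And>v. eval_poly P v = f v \<Longrightarrow> eval_poly Q v = g v \<Longrightarrow> eval_poly R v = h v"
  shows "agrees_with_poly h R"
proof -
  obtain N N' where N: "\<forall>v. (\<forall>l. N \<le> v l) \<longrightarrow> eval_poly P v = f v"
    "\<forall>v. (\<forall>l. N' \<le> v l) \<longrightarrow> eval_poly Q v = g v"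
    using assms(1,2) unfolding agrees_with_poly_def by blast
  then show ?thesis
    unfolding agrees_with_poly_def by (intro exI[of _ "max N N'"] allI impI assms(3)) simp_all
qed

lemma agrees_with_poly_diff:
  "agrees_with_poly f P \<Longrightarrow> agrees_with_poly g Q \<Longrightarrow> agrees_with_poly (\<lambda>v. f v - g v) (P - Q)"
  by (rule agrees_with_poly_combine[of f P g Q]) (simp_all add: eval_poly_diff)

lemma agrees_with_poly_mult:
  "agrees_with_poly f P \<Longrightarrow> agrees_with_poly g Q \<Longrightarrow> agrees_with_poly (\<lambda>v. f v * g v) (P * Q)"
  by (rule agrees_with_poly_combine[of f P g Q]) (simp_all add: eval_poly_mult)

lemma agrees_with_poly_add:
  "agrees_with_poly f P \<Longrightarrow> agrees_with_poly g Q \<Longrightarrow> agrees_with_poly (\<lambda>v. f v + g v) (P + Q)"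
  by (rule agrees_with_poly_combine[of f P g Q]) (simp_all add: eval_poly_add)

lemma agrees_with_poly_const: "agrees_with_poly (\<lambda>_. c) (Poly_Mapping.single 0 c)"
  by (simp add: agrees_with_poly_def eval_poly_single monomial_value_def)

lemma agrees_with_poly_var:
  "agrees_with_poly (\<lambda>v. of_nat (v l)) (Poly_Mapping.single (Poly_Mapping.single l 1) 1)"
proof -
  have "monomial_value v (Poly_Mapping.single l 1) = of_nat (v l)" for v
    unfolding monomial_value_def lookup_single when_def
    by (subst prod.remove[of _ l]) auto
  then show ?thesis by (simp add: agrees_with_poly_def eval_poly_single)
qed

lemma agrees_with_poly_sum:
  "(\<And>i. i \<in> A \<Longrightarrow> agrees_with_poly (f i) (P i)) \<Longrightarrow>
    agrees_with_poly (\<lambda>v. \<Sum>i\<in>A. f i v) (\<Sum>i\<in>A. P i)"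
proof (induction A rule: infinite_finite_induct)
  case (insert x F)
  then show ?case by (simp add: agrees_with_poly_add)
qed (auto simp: agrees_with_poly_def)

lemma agrees_with_poly_prod:
  "(\<And>i. i \<in> A \<Longrightarrow> agrees_with_poly (f i) (P i)) \<Longrightarrow>
    agrees_with_poly (\<lambda>v. \<Prod>i\<in>A. f i v) (\<Prod>i\<in>A. P i)"
proof (induction A rule: infinite_finite_induct)
  case (insert x F)
  then show ?case by (simp add: agrees_with_poly_mult)
next
  case empty
  then show ?case using agrees_with_poly_const[of 1] by simp
next
  case (infinite A)
  then show ?case using agrees_with_poly_const[of 1] by simp
qed

text \<open>The number of monomials of degree \<open>d\<close> in \<open>g\<close> variables. The case \<open>g = 0\<close> is separate because
  there truncated subtraction turns the binomial coefficient into 1 for all \<open>d\<close>.\<close>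

definition monomial_count :: "nat \<Rightarrow> nat \<Rightarrow> nat" where
  "monomial_count g d = (if g = 0 then (if d = 0 then 1 else 0) else (d + g - 1) choose (g - 1))"

text \<open>Pascal's rule. It reflects the splitting of monomials into those without a chosen
  variable and the multiples of that variable.\<close>

lemma monomial_count_Suc:
  "monomial_count (Suc g) d = monomial_count g d + (if d = 0 then 0 else monomial_count (Suc g) (d - 1))"
  by (cases g; cases d) (auto simp: monomial_count_def)

lemma agrees_with_poly_monomial_count:
  "\<exists>P. agrees_with_poly (\<lambda>v. of_nat (monomial_count g (v (l :: 'p::finite)))) P"
proof (cases g)
  \<comment> \<open>Without variables there are no monomials of positive degree, so the zero
    polynomial agrees with the count from the bound 1 on.\<close>
  case 0
  then show ?thesis
    unfolding agrees_with_poly_def monomial_count_def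
    by (intro exI[of _ "0 :: ('p \<Rightarrow>\<^sub>0 nat) \<Rightarrow>\<^sub>0 rat"] exI[of _ 1]) (auto simp: Suc_le_eq)
next
  case (Suc h)
  \<comment> \<open>For g = h + 1 the count is the binomial coefficient of d + h over h: a product
    of h linear factors in d, divided by the factorial of h.\<close>
  have eq: "of_nat (monomial_count g d) = (\<Prod>i<h. (of_nat d + (of_nat h - of_nat i))) * (1 / fact h :: rat)" for d
    unfolding monomial_count_def Suc
    by (simp add: binomial_gbinomial gbinomial_prod_rev atLeast0LessThan add_diff_eq)
  show ?thesis
    unfolding eq
    by (rule exI, rule agrees_with_poly_mult[OF agrees_with_poly_prod agrees_with_poly_const],
        rule agrees_with_poly_add[OF agrees_with_poly_var agrees_with_poly_const])
qed

section \<open>Monomials of a given multidegree under a standard grading\<close>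

lemma multidegree_ge:
  assumes "standard_grading \<delta>"
  obtains l where "lookup m i \<le> multidegree \<delta> m l"
proof -
  obtain l where "\<delta> i = unit_vector l" using assms by (auto simp: standard_grading_def)
  then have "\<delta> i l = 1" by (simp add: unit_vector_def)
  moreover have "lookup m i * \<delta> i l \<le> (\<Sum>i\<in>UNIV. lookup m i * \<delta> i l)"
    by (rule member_le_sum) auto
  ultimately show ?thesis using that[of l] by (simp add: multidegree_def)
qed

lemma finite_multidegree:
  fixes \<delta> :: "'v::finite \<Rightarrow> 'p::finite \<Rightarrow> nat"
  assumes "standard_grading \<delta>"
  shows "finite {m. multidegree \<delta> m = v}"
proof (rule finite_subset)
  show "{m. multidegree \<delta> m = v} \<subseteq> {m. keys m \<subseteq> UNIV \<and> (\<forall>i. lookup m i \<le> Max (range v))}"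
  proof clarsimp
    fix m i
    obtain l where "lookup m i \<le> multidegree \<delta> m l" by (rule multidegree_ge[OF assms])
    also have "\<dots> \<le> Max (range (multidegree \<delta> m))" by simp
    finally show "lookup m i \<le> Max (range (multidegree \<delta> m))" .
  qed
qed (rule finite_exponents)

lemma multidegree_add: "multidegree \<delta> (a + b) l = multidegree \<delta> a l + multidegree \<delta> b l"
  by (simp add: multidegree_def lookup_add algebra_simps sum.distrib)

lemma multidegree_single: "multidegree \<delta> (Poly_Mapping.single i 1) = \<delta> i"
  unfolding multidegree_def lookup_single when_def
  by (rule ext, subst sum.remove[of _ i]) auto

text \<open>A standard grading partitions the variables into blocks, and coordinate l of the
  multidegree is the total degree in block l, so the count factors over l. When a variable x of
  block l is added, an inner induction on \<open>v l\<close> separates the monomials without x from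
  the multiples of x, in parallel with \<open>monomial_count_Suc\<close>.\<close>

lemma card_monomials_supported:
  fixes \<delta> :: "'v::finite \<Rightarrow> 'p::finite \<Rightarrow> nat"
  assumes \<delta>: "standard_grading \<delta>"
  shows "card {m. keys m \<subseteq> G \<and> multidegree \<delta> m = v} =
    (\<Prod>l\<in>UNIV. monomial_count (card {i\<in>G. \<delta> i = unit_vector l}) (v l))"
  using finite[of G]
proof (induction G arbitrary: v rule: finite_induct)
  case empty
  show ?case
  proof (cases "\<forall>l. v l = 0")
    case True
    then have "{m. keys m \<subseteq> {} \<and> multidegree \<delta> m = v} = {0}"
      by (auto simp: multidegree_def)
    then have "card {m. keys m \<subseteq> {} \<and> multidegree \<delta> m = v} = card {0 :: 'v \<Rightarrow>\<^sub>0 nat}"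
      by (rule arg_cong)
    also have "\<dots> = (\<Prod>l\<in>UNIV. monomial_count (card {i\<in>{}. \<delta> i = unit_vector l}) (v l))"
      using True by (simp add: monomial_count_def)
    finally show ?thesis .
  next
    case False
    then obtain l where l: "v l \<noteq> 0" by blast
    then have "{m. keys m \<subseteq> {} \<and> multidegree \<delta> m = v} = {}"
      by (auto simp: multidegree_def)
    then have "card {m. keys m \<subseteq> {} \<and> multidegree \<delta> m = v} = 0" by (simp only: card.empty)
    moreover have "(\<Prod>l\<in>UNIV. monomial_count (card {i\<in>{}. \<delta> i = unit_vector l}) (v l)) = 0"
      using l by (intro prod_zero bexI[of _ l]) (simp_all add: monomial_count_def)
    ultimately show ?thesis by (rule trans[OF _ sym])
  qed
next
  case (insert x G)
  obtain l where l: "\<delta> x = unit_vector l" using \<delta> by (auto simp: standard_grading_def)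
  have unit: "unit_vector l = unit_vector l' \<longleftrightarrow> l' = l" for l' :: 'p
    by (auto simp: unit_vector_def fun_eq_iff split: if_splits)
  define g where "g l = card {i\<in>G. \<delta> i = unit_vector l}" for l
  define g' where "g' l = card {i\<in>insert x G. \<delta> i = unit_vector l}" for l
  have g': "g' l' = (if l' = l then Suc (g l') else g l')" for l'
  proof (cases "l' = l")
    case True
    then have "{i\<in>insert x G. \<delta> i = unit_vector l'} = insert x {i\<in>G. \<delta> i = unit_vector l'}"
      using l by auto
    then show ?thesis using True insert.hyps by (simp add: g_def g'_def)
  next
    case False
    then have "\<delta> x \<noteq> unit_vector l'" unfolding l unit .
    then have "{i\<in>insert x G. \<delta> i = unit_vector l'} = {i\<in>G. \<delta> i = unit_vector l'}" by blast
    then show ?thesis using False by (simp add: g_def g'_def)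
  qed
  define S where "S v = {m. keys m \<subseteq> insert x G \<and> multidegree \<delta> m = v}" for v
  have fin: "finite (S v)" for v
    using finite_multidegree[OF \<delta>, of v] by (rule finite_subset[rotated]) (auto simp: S_def)
  have IH: "card {m \<in> S v. lookup m x = 0} = (\<Prod>l\<in>UNIV. monomial_count (g l) (v l))" for v
  proof -
    have "{m \<in> S v. lookup m x = 0} = {m. keys m \<subseteq> G \<and> multidegree \<delta> m = v}"
      using insert.hyps(2) by (auto simp: S_def in_keys_iff)
    then show ?thesis using insert.IH by (simp add: g_def)
  qed
  define e where "e = Poly_Mapping.single x (1::nat)"
  have e: "lookup e i = (if i = x then 1 else 0)" "keys e = {x}" for i
    by (simp_all add: e_def lookup_single when_def)
  have deg: "multidegree \<delta> (m + e) = (multidegree \<delta> m)(l := Suc (multidegree \<delta> m l))" for m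
    by (rule ext) (simp add: multidegree_add multidegree_single[simplified] e_def l unit_vector_def)
  have "card (S v) = (\<Prod>l\<in>UNIV. monomial_count (g' l) (v l))" if "v l = d" for d v
    using that
  proof (induction d arbitrary: v)
    have split: "card (S v) = card {m \<in> S v. lookup m x = 0} + card {m \<in> S v. lookup m x \<noteq> 0}" for v
      using fin by (subst card_Un_disjoint[symmetric]) (auto intro!: arg_cong[of _ _ card])
    have prod: "(\<Prod>l\<in>UNIV. monomial_count (g' l) (v l)) =
        monomial_count (Suc (g l)) (v l) * (\<Prod>l'\<in>UNIV - {l}. monomial_count (g l') (v l'))"
      "(\<Prod>l\<in>UNIV. monomial_count (g l) (v l)) =
        monomial_count (g l) (v l) * (\<Prod>l'\<in>UNIV - {l}. monomial_count (g l') (v l'))" for v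
      by (simp_all add: prod.remove[of UNIV l] g')
    {
      case 0
      have "{m \<in> S v. lookup m x \<noteq> 0} = {}"
      proof (clarsimp simp: S_def)
        fix m assume m: "keys m \<subseteq> insert x G" "v = multidegree \<delta> m"
        have "lookup m x * \<delta> x l \<le> (\<Sum>i\<in>UNIV. lookup m i * \<delta> i l)"
          by (rule member_le_sum) auto
        also have "\<dots> = 0" using 0 m(2) by (simp add: multidegree_def)
        finally show "lookup m x = 0" by (simp add: l unit_vector_def)
      qed
      then have "card {m \<in> S v. lookup m x \<noteq> 0} = 0" by (simp only: card.empty)
      then show ?case
        using 0 unfolding split[of v] IH prod by (simp add: monomial_count_Suc[of "g l" 0])
    next
      case (Suc d)
      \<comment> \<open>Multiplication by x raises the degree at l from d to \<open>Suc d\<close>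
        and fixes the other coordinates. The quotient of a multiple of x may contain x again, so the
        source is a set \<open>S\<close> over \<open>insert x G\<close> and not one over
        \<open>G\<close>.\<close>
      have "bij_betw (\<lambda>m. m + e) (S (v(l := d))) {m \<in> S v. lookup m x \<noteq> 0}"
      proof (rule bij_betwI')
        fix m assume "m \<in> S (v(l := d))"
        then show "m + e \<in> {m \<in> S v. lookup m x \<noteq> 0}"
          using Suc.prems by (auto simp: S_def deg lookup_add keys_add_exponents e fun_upd_idem)
      next
        fix m assume m: "m \<in> {m \<in> S v. lookup m x \<noteq> 0}"
        define m' where "m' = m - e"
        have mm': "m = m' + e"
          using m by (intro poly_mapping_eqI)
            (auto simp: m'_def lookup_add lookup_minus e)
        have "multidegree \<delta> m' = v(l := d)"
          using m deg[of m'] Suc.prems unfolding mm'[symmetric] S_def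
          by (auto simp: fun_eq_iff split: if_splits)
        moreover have "keys m' \<subseteq> insert x G"
          using m keys_add_exponents[of m' e] mm' by (simp add: S_def)
        ultimately show "\<exists>m'\<in>S (v(l := d)). m = m' + e"
          using mm' by (auto simp: S_def)
      qed simp
      then have "card {m \<in> S v. lookup m x \<noteq> 0} = card (S (v(l := d)))"
        by (rule bij_betw_same_card[symmetric])
      also have "\<dots> = (\<Prod>l'\<in>UNIV. monomial_count (g' l') ((v(l := d)) l'))"
        by (rule Suc.IH) simp
      also have "\<dots> = monomial_count (Suc (g l)) d * (\<Prod>l'\<in>UNIV - {l}. monomial_count (g l') (v l'))"
        unfolding prod by (intro arg_cong2[of _ _ _ _ "(*)"] prod.cong) auto
      finally show ?case
        using Suc.prems unfolding split[of v] IH prod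
        by (simp add: monomial_count_Suc[of "g l" "Suc d"] algebra_simps)
    }
  qed
  then show ?case by (simp add: S_def g'_def)
qed

definition face_count :: "('v::finite \<Rightarrow> 'p::finite \<Rightarrow> nat) \<Rightarrow> 'v set \<Rightarrow> ('p \<Rightarrow> nat) \<Rightarrow> nat" where
  "face_count \<delta> G v = card {m. keys m = G \<and> multidegree \<delta> m = v}"

lemma card_monomials_complex:
  fixes \<delta> :: "'v::finite \<Rightarrow> 'p::finite \<Rightarrow> nat"
  assumes "standard_grading \<delta>"
  shows "card {m. keys m \<in> D \<and> multidegree \<delta> m = v} = (\<Sum>G\<in>D. face_count \<delta> G v)"
proof -
  have "{m. keys m \<in> D \<and> multidegree \<delta> m = v} = (\<Union>G\<in>D. {m. keys m = G \<and> multidegree \<delta> m = v})"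
    by auto
  also have "card \<dots> = (\<Sum>G\<in>D. face_count \<delta> G v)"
    unfolding face_count_def
    by (rule card_UN_disjoint)
       (auto intro: finite_subset[OF _ finite_multidegree[OF assms, of v]])
  finally show ?thesis .
qed

text \<open>Moebius inversion in recursive form: the monomials supported inside G are counted by a
  product of eventually polynomial functions, and removing those with smaller support, covered by
  induction, leaves the ones with support exactly G.\<close>

lemma ex_face_poly:
  fixes \<delta> :: "'v::finite \<Rightarrow> 'p::finite \<Rightarrow> nat"
  assumes \<delta>: "standard_grading \<delta>"
  shows "\<exists>P. agrees_with_poly (\<lambda>v. of_nat (face_count \<delta> G v)) P"
  using finite[of G]
proof (induction G rule: finite_psubset_induct)
  case (psubset G)
  then obtain Q where Q: "\<forall>H\<in>Pow G - {G}. agrees_with_poly (\<lambda>v. of_nat (face_count \<delta> H v)) (Q H)"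
    using bchoice[of "Pow G - {G}" "\<lambda>H P. agrees_with_poly (\<lambda>v. of_nat (face_count \<delta> H v)) P"] by blast
  have "\<forall>l. \<exists>P. agrees_with_poly (\<lambda>v. of_nat (monomial_count (card {i\<in>G. \<delta> i = unit_vector l}) (v l))) P"
    by (rule allI, rule agrees_with_poly_monomial_count)
  from choice[OF this] obtain R where R: "\<forall>l. agrees_with_poly
      (\<lambda>v. of_nat (monomial_count (card {i\<in>G. \<delta> i = unit_vector l}) (v l))) (R l)" ..
  have eq: "of_nat (face_count \<delta> G v) =
      (\<Prod>l\<in>UNIV. of_nat (monomial_count (card {i\<in>G. \<delta> i = unit_vector l}) (v l))) -
      (\<Sum>H\<in>Pow G - {G}. of_nat (face_count \<delta> H v) :: rat)" for v
  proof -
    have "(\<Prod>l\<in>UNIV. monomial_count (card {i\<in>G. \<delta> i = unit_vector l}) (v l)) =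
        (\<Sum>H\<in>Pow G. face_count \<delta> H v)"
      using card_monomials_complex[OF \<delta>, of "Pow G" v] card_monomials_supported[OF \<delta>, of G v] by simp
    also have "\<dots> = face_count \<delta> G v + (\<Sum>H\<in>Pow G - {G}. face_count \<delta> H v)"
      by (rule sum.remove) auto
    finally show ?thesis by (simp flip: of_nat_prod of_nat_sum)
  qed
  show ?case
    unfolding eq
    using agrees_with_poly_diff[OF agrees_with_poly_prod[of UNIV, OF R[rule_format]]
      agrees_with_poly_sum[of "Pow G - {G}", OF Q[rule_format]]] by (rule exI)
qed

definition face_poly :: "('v::finite \<Rightarrow> 'p::finite \<Rightarrow> nat) \<Rightarrow> 'v set \<Rightarrow> ('p \<Rightarrow>\<^sub>0 nat) \<Rightarrow>\<^sub>0 rat" where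
  "face_poly \<delta> G = (SOME P. agrees_with_poly (\<lambda>v. of_nat (face_count \<delta> G v)) P)"

lemma hilbert_polynomial_face_ideal:
  fixes \<delta> :: "'v::finite \<Rightarrow> 'p::finite \<Rightarrow> nat"
  assumes \<delta>: "standard_grading \<delta>" and D: "down_closed D"
  shows "hilbert_polynomial \<delta> (face_ideal D :: ('v, 'k::field) mpolynomial set) = (\<Sum>G\<in>D. face_poly \<delta> G)"
proof -
  have hf: "hilbert_function \<delta> (face_ideal D :: ('v, 'k) mpolynomial set) v = (\<Sum>G\<in>D. face_count \<delta> G v)" for v
    using hilbert_function_face_ideal[OF D, of \<delta> v] card_monomials_complex[OF \<delta>, of D v]
      finite_subset[OF _ finite_multidegree[OF \<delta>, of v]] by auto
  have "agrees_with_poly (\<lambda>v. of_nat (face_count \<delta> G v)) (face_poly \<delta> G)" for G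
    unfolding face_poly_def using ex_face_poly[OF \<delta>] by (rule someI_ex)
  then have "agrees_with_poly
      (\<lambda>v. of_nat (hilbert_function \<delta> (face_ideal D :: ('v, 'k) mpolynomial set) v)) (\<Sum>G\<in>D. face_poly \<delta> G)"
    unfolding hf of_nat_sum by (rule agrees_with_poly_sum)
  then show ?thesis
    unfolding hilbert_polynomial_def agrees_with_poly_def[symmetric]
    by (intro the_equality agrees_with_poly_unique)
qed


section \<open>Shellings\<close>

lemma mem_facets_superset:
  fixes G :: "'v::finite set"
  assumes "G \<in> \<Delta>"
  shows "\<exists>F\<in>facets \<Delta>. G \<subseteq> F"
proof -
  obtain F where F: "F \<in> {H \<in> \<Delta>. G \<subseteq> H}" "\<forall>H\<in>{H \<in> \<Delta>. G \<subseteq> H}. F \<subseteq> H \<longrightarrow> F = H"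
    using finite_has_maximal[of "{H \<in> \<Delta>. G \<subseteq> H}"] assms by auto
  then have "F \<in> facets \<Delta>" unfolding facets_def by blast
  then show ?thesis using F(1) by blast
qed

lemma remdups_map_inj:
  assumes "inj_on f (set xs)"
  shows "remdups (map f xs) = map f (remdups xs)"
  using assms by (induction xs) auto

text \<open>A sum of primes corresponds to an intersection of simplices, and summing
  \<open>face_poly\<close> is an additive function of the set of faces, so this is
  inclusion-exclusion for a union of simplices.\<close>

lemma IE_face_primes:
  fixes \<delta> :: "'v::finite \<Rightarrow> 'p::finite \<Rightarrow> nat"
  assumes \<delta>: "standard_grading \<delta>"
  shows "IE \<delta> (map (\<lambda>G. face_ideal (Pow G) :: ('v, 'k::field) mpolynomial set) Gs) =
    (\<Sum>H\<in>(\<Union>G\<in>set Gs. Pow G). face_poly \<delta> H)"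
proof -
  define n where "n = length Gs"
  define q where "q i = map (\<lambda>G. face_ideal (Pow G) :: ('v, 'k) mpolynomial set) Gs ! i" for i
  have hp: "hilbert_polynomial \<delta> (ideal_sum mpoly_ring q A) = (\<Sum>H\<in>(\<Inter>i\<in>A. Pow (Gs ! i)). face_poly \<delta> H)"
    if A: "A \<subseteq> {..<n}" "A \<noteq> {}" for A
  proof -
    have "(\<Union>i\<in>A. q i) = (\<Union>i\<in>A. face_ideal (Pow (Gs ! i)))"
      using A(1) by (intro SUP_cong refl) (auto simp: q_def n_def)
    then have "ideal_sum mpoly_ring q A = face_ideal (\<Inter>i\<in>A. Pow (Gs ! i))"
      using A(2) genideal_face_ideals[of A "\<lambda>i. Pow (Gs ! i)"] by (simp add: ideal_sum_def)
    moreover have "down_closed (\<Inter>i\<in>A. Pow (Gs ! i))" by (auto simp: down_closed_def)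
    ultimately show ?thesis by (simp only: hilbert_polynomial_face_ideal[OF \<delta>])
  qed
  have hp_empty: "hilbert_polynomial \<delta> (ideal_sum mpoly_ring q {}) = 0"
    using hilbert_polynomial_face_ideal[OF \<delta>, of "{}", where 'k = 'k]
    by (simp add: ideal_sum_def down_closed_def)
  have "IE \<delta> (map (\<lambda>G. face_ideal (Pow G) :: ('v, 'k) mpolynomial set) Gs) =
      (\<Sum>A\<in>Pow {..<n}. (-1) ^ (card A + 1) * hilbert_polynomial \<delta> (ideal_sum mpoly_ring q A))"
    by (simp only: IE_def q_def[abs_def] n_def length_map)
  \<comment> \<open>The empty index set stands for the whole ring, whose quotient has Hilbert
    polynomial 0, while inclusion-exclusion ranges over nonempty index sets.\<close>
  also have "\<dots> = (\<Sum>A | A \<subseteq> {..<n} \<and> A \<noteq> {}. (-1) ^ (card A + 1) * hilbert_polynomial \<delta> (ideal_sum mpoly_ring q A))"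
    by (rule sum.mono_neutral_right) (auto simp: hp_empty)
  also have "\<dots> = (\<Sum>A | A \<subseteq> {..<n} \<and> A \<noteq> {}. (-1) ^ (card A + 1) *
      (\<Sum>H\<in>(\<Inter>i\<in>A. Pow (Gs ! i)). face_poly \<delta> H))"
    by (intro sum.cong refl) (simp add: hp)
  also have "\<dots> = (\<Sum>H\<in>(\<Union>i\<in>{..<n}. Pow (Gs ! i)). face_poly \<delta> H)"
    by (rule Incl_Excl_UN[symmetric]) (simp_all add: sum.union_disjoint disjnt_def)
  also have "(\<Union>i\<in>{..<n}. Pow (Gs ! i)) = (\<Union>G\<in>set Gs. Pow G)"
    by (auto simp: n_def set_conv_nth)
  finally show ?thesis .
qed

text \<open>A simplex added to the union contributes its own sum minus the sum over its faces
  already present. The latter are what the correction terms have to account for.\<close>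

lemma sum_Union_Pow:
  fixes e :: "'v::finite set \<Rightarrow> 'a::ab_group_add" and n :: nat
  shows "(\<Sum>G\<in>(\<Union>j\<in>{1..n}. Pow (F j)). e G) =
    (\<Sum>j = 1..n. (\<Sum>G\<in>Pow (F j). e G) - (\<Sum>G\<in>Pow (F j) \<inter> (\<Union>l\<in>{1..<j}. Pow (F l)). e G))"
proof (induction n)
  case (Suc n)
  let ?U = "\<Union>j\<in>{1..n}. Pow (F j)"
  have "(\<Union>j\<in>{1..Suc n}. Pow (F j)) = Pow (F (Suc n)) \<union> ?U" by (auto simp: atLeastAtMostSuc_conv)
  moreover have "(\<Sum>G\<in>Pow (F (Suc n)) \<union> ?U. e G) + (\<Sum>G\<in>Pow (F (Suc n)) \<inter> ?U. e G) =
      (\<Sum>G\<in>Pow (F (Suc n)). e G) + (\<Sum>G\<in>?U. e G)"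
    by (rule sum.union_inter) auto
  ultimately show ?case
    using Suc.IH by (simp add: atLeastLessThanSuc_atLeastAtMost algebra_simps)
qed simp

text \<open>A prime contains the ideal generated by its variables, but it could be larger. Equality
  comes from comparing the two intersections that represent the ideal, since no facet contains
  another.\<close>

lemma face_ideal_primary_components:
  fixes p :: "nat \<Rightarrow> ('v::finite, 'k::field) mpolynomial set"
  assumes D: "down_closed D" and J: "face_ideal D = (\<Inter>i\<in>{1..k}. p i)"
    and prime: "\<And>i. i \<in> {1..k} \<Longrightarrow> primeideal (p i) mpoly_ring"
    and facets: "facets D = (\<lambda>i. face_of_prime (p i)) ` {1..k}" "inj_on (\<lambda>i. face_of_prime (p i)) {1..k}"
  shows "D = (\<Union>i\<in>{1..k}. Pow (face_of_prime (p i)))"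
    and "\<And>i. i \<in> {1..k} \<Longrightarrow> p i = face_ideal (Pow (face_of_prime (p i)))"
proof -
  define F where "F i = face_of_prime (p i)" for i
  have sub: "face_ideal (Pow (F i)) \<subseteq> p i" if "i \<in> {1..k}" for i
    using prime[OF that]
    by (intro face_prime_subsetI) (auto simp: F_def face_of_prime_def primeideal_mpoly_iff)
  have facet: "F i \<in> D" "G \<in> D \<Longrightarrow> F i \<subseteq> G \<Longrightarrow> F i = G" if "i \<in> {1..k}" for i G
    using facets(1) that unfolding F_def facets_def by blast+
  have same: "i = l" if "i \<in> {1..k}" "l \<in> {1..k}" "F i \<subseteq> F l" for i l
    using inj_onD[OF facets(2)] facet(2)[OF that(1) facet(1)[OF that(2)] that(3)] that(1,2)
    by (simp only: F_def)
  show DF: "D = (\<Union>i\<in>{1..k}. Pow (face_of_prime (p i)))"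
    unfolding F_def[symmetric]
  proof (intro equalityI subsetI)
    fix G assume "G \<in> D"
    then obtain H where "H \<in> facets D" "G \<subseteq> H" using mem_facets_superset by blast
    then show "G \<in> (\<Union>i\<in>{1..k}. Pow (F i))" unfolding facets(1) F_def[symmetric] by auto
  next
    fix G assume "G \<in> (\<Union>i\<in>{1..k}. Pow (F i))"
    then obtain i where "i \<in> {1..k}" "G \<subseteq> F i" by blast
    then show "G \<in> D" using facet(1)[of i] D unfolding down_closed_def by blast
  qed
  have J': "face_ideal D = (\<Inter>i\<in>{1..k}. face_ideal (Pow (F i)) :: ('v, 'k) mpolynomial set)"
    unfolding F_def by (subst DF, rule face_ideal_Union)
  fix i assume i: "i \<in> {1..k}"
  \<comment> \<open>The face prime of \<open>F i\<close> is prime and contains the intersection of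
    all \<open>p l\<close>, hence contains one of them. That \<open>p l\<close> in turn contains the
    face prime of \<open>F l\<close>, so \<open>F i \<subseteq> F l\<close>, which forces l =
    i.\<close>
  have "\<exists>l\<in>{1..k}. p l \<subseteq> face_ideal (Pow (F i))"
  proof (rule primeideal_finite_Inter[OF primeideal_face_ideal_Pow])
    show "(\<Inter>l\<in>{1..k}. p l) \<subseteq> face_ideal (Pow (F i))"
      unfolding J[symmetric] J' using i by (rule INF_lower)
    show "ideal (p l) mpoly_ring" if "l \<in> {1..k}" for l
      using prime[OF that] by (simp add: primeideal_mpoly_iff)
  qed simp
  then obtain l where l: "l \<in> {1..k}" "p l \<subseteq> face_ideal (Pow (F i))" by blast
  then have "face_ideal (Pow (F l)) \<subseteq> (face_ideal (Pow (F i)) :: ('v, 'k) mpolynomial set)"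
    using sub by blast
  then have "F i \<subseteq> F l" using face_ideal_subset_imp by blast
  then have "l = i" using same i l(1) by blast
  then show "p i = face_ideal (Pow (face_of_prime (p i)))"
    using l(2) sub[OF i] unfolding F_def by blast
qed

text \<open>A common face of \<open>F j\<close> and an earlier facet extends to a facet G of the
  intersection complex. G lies in some \<open>F l \<inter> F j\<close>, itself a face of that
  complex, so the two are equal by maximality, and purity says that G has one vertex less than
  \<open>F j\<close>.\<close>

lemma shelling_order_intersection:
  fixes F :: "nat \<Rightarrow> 'v::finite set"
  assumes shelling: "shelling_order \<Delta> F k" and j: "j \<in> {1..k}"
  shows "Pow (F j) \<inter> (\<Union>l\<in>{1..<j}. Pow (F l)) =
    (\<Union>G\<in>{G. \<exists>l\<in>{1..<j}. G = F l \<inter> F j \<and> Suc (card G) = card (F j)}. Pow G)"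
proof
  show "(\<Union>G\<in>{G. \<exists>l\<in>{1..<j}. G = F l \<inter> F j \<and> Suc (card G) = card (F j)}. Pow G) \<subseteq>
      Pow (F j) \<inter> (\<Union>l\<in>{1..<j}. Pow (F l))" by auto
  show "Pow (F j) \<inter> (\<Union>l\<in>{1..<j}. Pow (F l)) \<subseteq>
      (\<Union>G\<in>{G. \<exists>l\<in>{1..<j}. G = F l \<inter> F j \<and> Suc (card G) = card (F j)}. Pow G)"
  proof
    fix H assume H: "H \<in> Pow (F j) \<inter> (\<Union>l\<in>{1..<j}. Pow (F l))"
    then have "j \<in> {2..k}" using j by auto
    define \<Gamma> where "\<Gamma> = generated_complex (F ` {1..j - 1}) \<inter> generated_complex {F j}"
    have pure: "pure_of_dim (face_dim (F j) - 1) \<Gamma>"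
      using shelling \<open>j \<in> {2..k}\<close> unfolding shelling_order_def \<Gamma>_def by blast
    have mem: "G \<in> \<Gamma> \<longleftrightarrow> G \<subseteq> F j \<and> (\<exists>l\<in>{1..<j}. G \<subseteq> F l)" for G
      using \<open>j \<in> {2..k}\<close> by (auto simp: \<Gamma>_def generated_complex_def Bex_def)
    have "H \<in> \<Gamma>" using H mem by auto
    then obtain G where G: "G \<in> facets \<Gamma>" "H \<subseteq> G" using mem_facets_superset by blast
    then obtain l where l: "l \<in> {1..<j}" "G \<subseteq> F l" "G \<subseteq> F j" using mem by (auto simp: facets_def)
    have "F l \<inter> F j \<in> \<Gamma>" using mem l(1) by auto
    then have "G = F l \<inter> F j" using G(1) l by (auto simp: facets_def)
    moreover have "Suc (card G) = card (F j)"
      using pure G(1) by (auto simp: pure_of_dim_def face_dim_def)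
    ultimately show "H \<in> (\<Union>G\<in>{G. \<exists>l\<in>{1..<j}. G = F l \<inter> F j \<and> Suc (card G) = card (F j)}. Pow G)"
      using l(1) G(2) by blast
  qed
qed

theorem proposition4p6:
  fixes \<delta> :: "'v::finite \<Rightarrow> 'p::finite \<Rightarrow> nat"
    and J :: "('v, 'k::field) mpolynomial set"
    and p :: "nat \<Rightarrow> ('v, 'k) mpolynomial set"
    and k c :: nat
  assumes "standard_grading \<delta>"
    and "squarefree_monomial_ideal J"
    and "minimal_primary_decomposition mpoly_ring J p k"
    and "\<And>i. i \<in> {1..k} \<Longrightarrow> primeideal (p i) mpoly_ring"
    and "shelling_order (stanley_reisner_complex J) (\<lambda>i. face_of_prime (p i)) k"
    and "\<And>i. i \<in> {1..k} \<Longrightarrow> codim mpoly_ring (p i) = enat c"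
  shows "hilbert_polynomial \<delta> J =
           (\<Sum>j = 1..k. hilbert_polynomial \<delta> (p j) - IE \<delta> (prime_seq p c j)) \<and>
         (\<forall>j\<in>{1..k}. \<exists>xs :: 'v list. distinct xs \<and>
            (\<forall>x\<in>set xs. Var x \<in> ideal_sum mpoly_ring p {1..j - 1} - p j) \<and>
            prime_seq p c j = map (\<lambda>x. p j <+>\<^bsub>mpoly_ring\<^esub> genideal mpoly_ring {Var x}) xs)"
proof -
  define D where "D = stanley_reisner_complex J"
  define F where "F i = face_of_prime (p i)" for i
  have J: "J = face_ideal D" and D: "down_closed D"
    using squarefree_monomial_ideal_eq_face_ideal[OF assms(2)] by (simp_all add: D_def)
  have shelling: "shelling_order D F k" using assms(5) by (simp add: D_def F_def[abs_def])
  have facets: "facets D = F ` {1..k}" "inj_on F {1..k}"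
    using shelling by (simp_all add: shelling_order_def)
  have "face_ideal D = (\<Inter>i\<in>{1..k}. p i)"
    using assms(3) by (simp add: minimal_primary_decomposition_def J)
  note comp = face_ideal_primary_components[OF D this assms(4), folded F_def, OF _ facets]
  have DF: "D = (\<Union>i\<in>{1..k}. Pow (F i))" by (rule comp(1))
  have p: "p i = face_ideal (Pow (F i))" if "i \<in> {1..k}" for i by (rule comp(2)[OF _ that])
  have c: "card (- F i) = c" if "i \<in> {1..k}" for i
    using assms(6)[OF that] unfolding p[OF that] codim_face_prime by simp
  \<comment> \<open>All facets have c vertices in their complement, so codimension c + 1 means
    exactly one vertex less than a facet.\<close>
  have card_compl: "card (- G) = c + 1 \<longleftrightarrow> Suc (card G) = card (F i)"
    if "i \<in> {1..k}" for G :: "'v set" and i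
  proof -
    have "card G + card (- G) = card (UNIV :: 'v set)" for G :: "'v set"
      using card_Un_disjoint[of G "- G"] by (simp add: Compl_partition)
    from this[of G] this[of "F i"] c[OF that] show ?thesis by linarith
  qed
  \<comment> \<open>This repeats the construction of \<open>prime_seq\<close> on faces, with the
    same order and the same treatment of repetitions. Since the passage from faces to ideals is
    injective, the two agree as lists.\<close>
  define Gs where "Gs j = remdups (filter (\<lambda>G. card (- G) = c + 1) (map (\<lambda>l. F l \<inter> F j) [1..<j]))" for j
  have set_Gs: "set (Gs j) = {G. \<exists>l\<in>{1..<j}. G = F l \<inter> F j \<and> Suc (card G) = card (F j)}"
    if "j \<in> {1..k}" for j
    unfolding Gs_def using card_compl[OF that] by auto
  have seq: "prime_seq p c j = map (\<lambda>G. face_ideal (Pow G)) (Gs j)" if j: "j \<in> {1..k}" for j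
  proof -
    have eq: "map (\<lambda>l. p l <+>\<^bsub>mpoly_ring\<^esub> p j) [1..<j] =
        map (\<lambda>G. face_ideal (Pow G)) (map (\<lambda>l. F l \<inter> F j) [1..<j])"
      using j by (auto simp: p set_add_face_ideals Pow_Int_eq)
    have "prime_seq p c j = remdups (map (\<lambda>G. face_ideal (Pow G))
        (filter (\<lambda>G. card (- G) = c + 1) (map (\<lambda>l. F l \<inter> F j) [1..<j])))"
      unfolding prime_seq_def eq by (simp only: filter_map o_def codim_face_prime enat.inject)
    also have "\<dots> = map (\<lambda>G. face_ideal (Pow G)) (Gs j)"
      unfolding Gs_def by (rule remdups_map_inj) (auto simp: inj_on_def face_ideal_eq_iff Pow_def)
    finally show ?thesis .
  qed
  have "hilbert_polynomial \<delta> J = (\<Sum>G\<in>D. face_poly \<delta> G)"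
    unfolding J by (rule hilbert_polynomial_face_ideal[OF assms(1) D])
  also have "\<dots> = (\<Sum>j = 1..k. (\<Sum>G\<in>Pow (F j). face_poly \<delta> G) -
      (\<Sum>G\<in>Pow (F j) \<inter> (\<Union>l\<in>{1..<j}. Pow (F l)). face_poly \<delta> G))"
    unfolding DF by (rule sum_Union_Pow)
  also have "\<dots> = (\<Sum>j = 1..k. hilbert_polynomial \<delta> (p j) - IE \<delta> (prime_seq p c j))"
  proof (rule sum.cong[OF refl])
    fix j assume j: "j \<in> {1..k}"
    show "(\<Sum>G\<in>Pow (F j). face_poly \<delta> G) -
        (\<Sum>G\<in>Pow (F j) \<inter> (\<Union>l\<in>{1..<j}. Pow (F l)). face_poly \<delta> G) =
        hilbert_polynomial \<delta> (p j) - IE \<delta> (prime_seq p c j)"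
      unfolding seq[OF j] IE_face_primes[OF assms(1)] set_Gs[OF j]
        shelling_order_intersection[OF shelling j, symmetric]
      unfolding p[OF j] hilbert_polynomial_face_ideal[OF assms(1) down_closed_Pow] ..
  qed
  finally have hp: "hilbert_polynomial \<delta> J =
      (\<Sum>j = 1..k. hilbert_polynomial \<delta> (p j) - IE \<delta> (prime_seq p c j))" .
  have "\<exists>xs :: 'v list. distinct xs \<and>
      (\<forall>x\<in>set xs. Var x \<in> ideal_sum mpoly_ring p {1..j - 1} - p j) \<and>
      prime_seq p c j = map (\<lambda>x. p j <+>\<^bsub>mpoly_ring\<^esub> genideal mpoly_ring {Var x}) xs"
    if j: "j \<in> {1..k}" for j
  proof -
    \<comment> \<open>The required variables are the vertices of \<open>F j\<close> missing from the
      faces in \<open>Gs j\<close>. Such a face is recovered from its missing vertex, so distinct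
      faces give distinct variables.\<close>
    have "\<exists>x. F j - G = {x}" if "G \<in> set (Gs j)" for G
    proof -
      have G: "G \<subseteq> F j" "Suc (card G) = card (F j)" using that set_Gs[OF j] by auto
      then have "card (F j - G) = 1" by (subst card_Diff_subset) auto
      then show ?thesis by (rule card_1_singletonE) blast
    qed
    then have "\<forall>G\<in>set (Gs j). \<exists>x. F j - G = {x}" by (rule ballI)
    from bchoice[OF this] obtain x where x: "\<forall>G\<in>set (Gs j). F j - G = {x G}" ..
    have G_eq: "G = F j - {x G}" if "G \<in> set (Gs j)" for G
    proof -
      have "G \<subseteq> F j" using that set_Gs[OF j] by auto
      then show ?thesis using x that by blast
    qed
    show ?thesis
    proof (intro exI[of _ "map x (Gs j)"] conjI ballI)
      have "inj_on x (set (Gs j))"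
      proof (rule inj_onI)
        fix G H assume "G \<in> set (Gs j)" "H \<in> set (Gs j)" "x G = x H"
        then show "G = H" using G_eq[of G] G_eq[of H] by simp
      qed
      then show "distinct (map x (Gs j))" by (simp add: distinct_map Gs_def)
      have "p j <+>\<^bsub>mpoly_ring\<^esub> genideal mpoly_ring {Var (x G)} = face_ideal (Pow G)"
        if "G \<in> set (Gs j)" for G
      proof -
        have "Pow (F j) \<inter> Pow (- {x G}) = Pow G" by (subst (2) G_eq[OF that]) blast
        then show ?thesis
          unfolding p[OF j] genideal_Var by (subst set_add_face_ideals) simp_all
      qed
      then show "prime_seq p c j = map (\<lambda>x. p j <+>\<^bsub>mpoly_ring\<^esub> genideal mpoly_ring {Var x}) (map x (Gs j))"
        unfolding seq[OF j] by simp
      fix y assume "y \<in> set (map x (Gs j))"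
      then obtain G where G: "G \<in> set (Gs j)" "y = x G" by auto
      then obtain l where l: "l \<in> {1..<j}" "G = F l \<inter> F j" using set_Gs[OF j] by blast
      have "y \<in> F j - G" using bspec[OF x G(1)] G(2) by simp
      then have y: "y \<in> F j" "y \<notin> F l" using l(2) by auto
      \<comment> \<open>As y is a vertex of \<open>F j\<close> but not of the earlier facet
        \<open>F l\<close>, its variable lies in \<open>p l\<close>, hence in the sum of the earlier
        primes, and not in \<open>p j\<close>.\<close>
      have "Var y \<in> (\<Union>i\<in>{1..j - 1}. p i)"
        using l(1) y(2) by (intro UN_I[of l]) (auto simp: F_def face_of_prime_def)
      moreover have "(\<Union>i\<in>{1..j - 1}. p i) \<subseteq> ideal_sum mpoly_ring p {1..j - 1}"
        using ring.genideal_self[OF ring_mpoly_ring, of "\<Union>i\<in>{1..j - 1}. p i"]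
        by (simp add: ideal_sum_def)
      ultimately have "Var y \<in> ideal_sum mpoly_ring p {1..j - 1}" by (rule rev_subsetD)
      moreover have "Var y \<notin> p j" using y(1) by (simp add: F_def face_of_prime_def)
      ultimately show "Var y \<in> ideal_sum mpoly_ring p {1..j - 1} - p j" by (rule DiffI)
    qed
  qed
  then show ?thesis using hp by (intro conjI ballI)
qed


end
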